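(* Let $\mathcal{P}$ be a pure logic program and consider its causal tile system. Let $\langle G,\ s,\ \theta,\ \Box^m\otimes!_{\underline n}\rangle$ be an entailed refutation tile for the goal $G$, and let $\sqsubseteq$ be the partial order on the nodes of the ordered forest described by the trigger $s$ ($x\sqsubseteq y$ iff $y$ descends from $x$), each node being labeled by a clause and corresponding to the subgoal that clause is applied to. Let $\preceq$ be any total order extending $\sqsubseteq$. Then applying (by SLD-resolution) the clauses associated to the nodes, to their corresponding subgoals, in the order specified by $\preceq$ yields again the computed answer substitution $\theta$.
   Context: Arrows: sorts $\mathsf{t}$, $\mathsf{p}$; function symbols $f\colon\mathsf{t}^n\to\mathsf{t}$, predicates $p\colon\mathsf{t}^k\to\mathsf{p}$; arrows of a free cartesian theory are tuples of terms over typed variables, with diagrammatic composition $;$ (substitution), juxtaposition $\otimes$, symmetries $\gamma$, duplicators $\nabla_{\underline n}$, dischargers $!_{\underline n}$. Causal tile system of $\mathcal{P}$: configurations are arrows of the free cartesian category generated by function symbols, predicate symbols and $\Box\colon\epsilon\to\mathsf{p}$ (no conjunction operator; a goal $A_1,\dots,A_k$ is the tuple $\langle A_1,\dots,A_k\rangle\colon\mathsf{t}^n\to\mathsf{p}^k$). Horizontal-to-vertical observations include function symbols on sort $\mathsf t$ and, for each clause $c\equiv p(t_1,\dots,t_k)\mathrel{:-}q_1(\vec s_1),\dots,q_m(\vec s_m)$, an operator $c\colon\mathsf{p}^m\to\mathsf{p}$; observations are arrows of the free cartesian category they generate. A tile $\langle s,u,v,r\rangle$ has initial configuration $s\colon o_1\to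 o_0$, trigger $u\colon o_2\to o_0$, effect $v\colon o_3\to o_1$, final configuration $r\colon o_3\to o_2$. Basic tiles: for each clause $c$ (over variables $x_1,\dots,x_n$) the tile $C_c=\langle p,\ c,\ \langle t_1,\dots,t_k\rangle,\ \langle q_1(\vec s_1),\dots,q_m(\vec s_m)\rangle\rangle$; and the pullback tiles, for each $n$-ary function symbol $f$: $\langle f,f,id,id\rangle$, $\langle f\otimes id_{\underline1},\nabla_{\underline1},\nabla_{\underline n};(id_{\underline n}\otimes f),f\rangle$, $\langle\nabla_{\underline1},f\otimes id_{\underline1},f,\nabla_{\underline n};(id_{\underline n}\otimes f)\rangle$, plus $\langle\nabla_{\underline1},\nabla_{\underline1},id_{\underline1},id_{\underline1}\rangle$, $\langle\gamma_{\underline1,\underline1},\gamma_{\underline1,\underline1},id_{\underline2},id_{\underline2}\rangle$, $\langle\nabla_{\underline1}\otimes id_{\underline1},id_{\underline1}\otimes\nabla_{\underline1},\nabla_{\underline1},\nabla_{\underline1}\rangle$. Entailed tiles are those obtained from basic and identity tiles ($\langle h,id,id,h\rangle$, $\langle id,v,v,id\rangle$) by horizontal composition $\langle s_1,u_1,v_1,r_1\rangle*\langle s_2,v_1,v_2,r_2\rangle=\langle s_2;s_1,u_1,v_2,r_2;r_1\rangle$, vertical composition $\langle s_1,u_1,v_1,r_1\rangle\cdot\langle r_1,u_2,v_2,r_2\rangle=\langle s_1,u_2;u_1,v_2;v_1,r_2\rangle$, and parallel composition $\otimes$. A refutation tile is an entailed tile of the form $\langle G,s,\theta,\Box^m\otimes!_{\underline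 n}\rangle$; its trigger $s$ is a tuple of terms over the clause operators without shared variables, i.e. an ordered forest of ordered trees whose nodes are labeled by clause names, the ordering giving the correspondence between each clause instance and the subgoal it is applied to. *)

theory Defs
  imports Main "HOL-Library.Sublist"
begin

section \<open>Free cartesian categories: tuples of terms\<close>

datatype sort = ST | SP

datatype 'o tm = Var nat | Op 'o "'o tm list"

primrec subst :: "(nat \<Rightarrow> 'o tm) \<Rightarrow> 'o tm \<Rightarrow> 'o tm" where
  "subst \<sigma> (Var i) = \<sigma> i"
| "subst \<sigma> (Op g us) = Op g (map (subst \<sigma>) us)"

primrec vars :: "'o tm \<Rightarrow> nat set" where
  "vars (Var i) = {i}"
| "vars (Op g us) = \<Union> (set (map vars us))"

text \<open>A signature is partial: operators mapped to \<^const>\<open>None\<close> do not belong to it.\<close>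

type_synonym 'o signature = "'o \<Rightarrow> (sort list \<times> sort) option"

inductive has_sort :: "'o signature \<Rightarrow> sort list \<Rightarrow> 'o tm \<Rightarrow> sort \<Rightarrow> bool"
  for S :: "'o signature" and \<Gamma> :: "sort list" where
  "i < length \<Gamma> \<Longrightarrow> has_sort S \<Gamma> (Var i) (\<Gamma> ! i)"
| "S g = Some (\<sigma>s, \<tau>) \<Longrightarrow> length us = length \<sigma>s \<Longrightarrow>
     (\<forall>j < length us. has_sort S \<Gamma> (us ! j) (\<sigma>s ! j)) \<Longrightarrow> has_sort S \<Gamma> (Op g us) \<tau>"

text \<open>An arrow \<open>Arr \<Gamma> \<Delta> us\<close> from \<open>\<Gamma>\<close> to \<open>\<Delta>\<close> is a tuple of terms, one for each position of
  \<open>\<Delta>\<close>, where \<open>Var i\<close> is the variable at position \<open>i\<close> of \<open>\<Gamma>\<close>.  Since arrows are terms, the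
  laws of cartesian categories hold as equations between arrows.\<close>

datatype 'o arr = Arr (src: "sort list") (tgt: "sort list") (tms: "'o tm list")

definition is_arr :: "'o signature \<Rightarrow> 'o arr \<Rightarrow> bool" where
  "is_arr S a \<longleftrightarrow> length (tms a) = length (tgt a) \<and>
     (\<forall>i < length (tms a). has_sort S (src a) (tms a ! i) (tgt a ! i))"

definition comp :: "'o arr \<Rightarrow> 'o arr \<Rightarrow> 'o arr"  (infixl \<open>;;\<close> 70) where
  "a ;; b = Arr (src a) (tgt b) (map (subst (\<lambda>i. tms a ! i)) (tms b))"

definition par :: "'o arr \<Rightarrow> 'o arr \<Rightarrow> 'o arr"  (infixl \<open>\<otimes>\<close> 75) where
  "a \<otimes> b = Arr (src a @ src b) (tgt a @ tgt b)
     (tms a @ map (subst (\<lambda>i. Var (length (src a) + i))) (tms b))"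

definition ident :: "sort list \<Rightarrow> 'o arr" where
  "ident \<Gamma> = Arr \<Gamma> \<Gamma> (map Var [0..<length \<Gamma>])"

definition swap :: "sort list \<Rightarrow> sort list \<Rightarrow> 'o arr" where
  "swap \<Gamma> \<Delta> = Arr (\<Gamma> @ \<Delta>) (\<Delta> @ \<Gamma>)
     (map Var [length \<Gamma>..<length \<Gamma> + length \<Delta>] @ map Var [0..<length \<Gamma>])"

definition dup :: "sort list \<Rightarrow> 'o arr" where
  "dup \<Gamma> = Arr \<Gamma> (\<Gamma> @ \<Gamma>) (map Var [0..<length \<Gamma>] @ map Var [0..<length \<Gamma>])"

definition disch :: "sort list \<Rightarrow> 'o arr" where
  "disch \<Gamma> = Arr \<Gamma> [] []"

definition op_arr :: "sort list \<Rightarrow> sort \<Rightarrow> 'o \<Rightarrow> 'o arr" where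
  "op_arr \<Gamma> \<tau> g = Arr \<Gamma> [\<tau>] [Op g (map Var [0..<length \<Gamma>])]"

abbreviation t_pow :: "nat \<Rightarrow> sort list"  (\<open>\<t>^_\<close> [1000] 1000) where
  "\<t>^n \<equiv> replicate n ST"

abbreviation p_pow :: "nat \<Rightarrow> sort list"  (\<open>\<p>^_\<close> [1000] 1000) where
  "\<p>^n \<equiv> replicate n SP"

section \<open>Pure logic programs\<close>

type_synonym ('f, 'p) atom = "'p \<times> 'f tm list"

text \<open>A clause over the variables \<open>Var 0, \<dots>, Var (nvars c - 1)\<close>.  Clauses serve as their own
  names; a fact has an empty body.\<close>

datatype ('f, 'p) clause =
  Clause (nvars: nat) (head: "('f, 'p) atom") (body: "('f, 'p) atom list")

definition fun_sig :: "('f \<Rightarrow> nat) \<Rightarrow> 'f signature" where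
  "fun_sig arF f = Some (\<t>^(arF f), ST)"

definition wf_atom :: "('f \<Rightarrow> nat) \<Rightarrow> ('p \<Rightarrow> nat) \<Rightarrow> nat \<Rightarrow> ('f, 'p) atom \<Rightarrow> bool" where
  "wf_atom arF arP n A \<longleftrightarrow> length (snd A) = arP (fst A) \<and>
     (\<forall>u \<in> set (snd A). has_sort (fun_sig arF) (\<t>^n) u ST)"

definition wf_clause :: "('f \<Rightarrow> nat) \<Rightarrow> ('p \<Rightarrow> nat) \<Rightarrow> ('f, 'p) clause \<Rightarrow> bool" where
  "wf_clause arF arP c \<longleftrightarrow> (\<forall>A \<in> set (head c # body c). wf_atom arF arP (nvars c) A)"

definition logic_program ::
  "('f \<Rightarrow> nat) \<Rightarrow> ('p \<Rightarrow> nat) \<Rightarrow> ('f, 'p) clause set \<Rightarrow> bool" where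
  "logic_program arF arP P \<longleftrightarrow> finite P \<and> (\<forall>c \<in> P. wf_clause arF arP c)"

section \<open>The causal tile system\<close>

datatype ('f, 'p) cop = CFun 'f | CPred 'p | CBox

datatype ('f, 'p) oop = OFun 'f | OClause "('f, 'p) clause"

fun conf_sig :: "('f \<Rightarrow> nat) \<Rightarrow> ('p \<Rightarrow> nat) \<Rightarrow> ('f, 'p) cop signature" where
  "conf_sig arF arP (CFun f) = Some (\<t>^(arF f), ST)"
| "conf_sig arF arP (CPred p) = Some (\<t>^(arP p), SP)"
| "conf_sig arF arP CBox = Some ([], SP)"

fun obs_sig :: "('f \<Rightarrow> nat) \<Rightarrow> ('f, 'p) clause set \<Rightarrow> ('f, 'p) oop signature" where
  "obs_sig arF P (OFun f) = Some (\<t>^(arF f), ST)"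
| "obs_sig arF P (OClause c) = (if c \<in> P then Some (\<p>^(length (body c)), SP) else None)"

text \<open>A substitution of the terms \<open>us\<close>, over \<open>n\<close> variables, for the variables
  \<open>Var 0, \<dots>, Var (length us - 1)\<close>, as an observation.\<close>

definition subst_obs :: "nat \<Rightarrow> 'f tm list \<Rightarrow> ('f, 'p) oop arr" where
  "subst_obs n us = Arr (\<t>^n) (\<t>^(length us)) (map (map_tm OFun) us)"

text \<open>A goal over \<open>n\<close> variables as a configuration.  The components of an arrow from
  \<open>\<t>^n\<close> to \<open>\<p>^k\<close> are atoms or the empty goal \<open>\<box>\<close>, the latter represented by \<^const>\<open>None\<close>.\<close>

fun subgoal_tm :: "('f, 'p) atom option \<Rightarrow> ('f, 'p) cop tm" where
  "subgoal_tm (Some (p, us)) = Op (CPred p) (map (map_tm CFun) us)"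
| "subgoal_tm None = Op CBox []"

definition goal_conf :: "nat \<Rightarrow> ('f, 'p) atom option list \<Rightarrow> ('f, 'p) cop arr" where
  "goal_conf n gs = Arr (\<t>^n) (\<p>^(length gs)) (map subgoal_tm gs)"

definition box_pow :: "nat \<Rightarrow> ('f, 'p) cop arr" where
  "box_pow m = Arr [] (\<p>^m) (replicate m (Op CBox []))"

text \<open>\<open>entailed arF arP P s u v r\<close>: the tile with initial configuration \<open>s\<close>, trigger \<open>u\<close>,
  effect \<open>v\<close> and final configuration \<open>r\<close> is entailed.\<close>

inductive entailed ::
  "('f \<Rightarrow> nat) \<Rightarrow> ('p \<Rightarrow> nat) \<Rightarrow> ('f, 'p) clause set \<Rightarrow>
   ('f, 'p) cop arr \<Rightarrow> ('f, 'p) oop arr \<Rightarrow> ('f, 'p) oop arr \<Rightarrow> ('f, 'p) cop arr \<Rightarrow> bool"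
  for arF :: "'f \<Rightarrow> nat" and arP :: "'p \<Rightarrow> nat" and P :: "('f, 'p) clause set" where
  clause: "c \<in> P \<Longrightarrow> head c = (p, us) \<Longrightarrow>
    entailed arF arP P
      (op_arr (\<t>^(arP p)) SP (CPred p))
      (op_arr (\<p>^(length (body c))) SP (OClause c))
      (subst_obs (nvars c) us)
      (goal_conf (nvars c) (map Some (body c)))"
| pb_fun: "entailed arF arP P
      (op_arr (\<t>^(arF f)) ST (CFun f)) (op_arr (\<t>^(arF f)) ST (OFun f))
      (ident (\<t>^(arF f))) (ident (\<t>^(arF f)))"
| pb_fun_dup: "entailed arF arP P
      (op_arr (\<t>^(arF f)) ST (CFun f) \<otimes> ident (\<t>^1)) (dup (\<t>^1))
      (dup (\<t>^(arF f)) ;; (ident (\<t>^(arF f)) \<otimes> op_arr (\<t>^(arF f)) ST (OFun f)))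
      (op_arr (\<t>^(arF f)) ST (CFun f))"
| pb_dup_fun: "entailed arF arP P
      (dup (\<t>^1)) (op_arr (\<t>^(arF f)) ST (OFun f) \<otimes> ident (\<t>^1))
      (op_arr (\<t>^(arF f)) ST (OFun f))
      (dup (\<t>^(arF f)) ;; (ident (\<t>^(arF f)) \<otimes> op_arr (\<t>^(arF f)) ST (CFun f)))"
| pb_dup: "entailed arF arP P (dup (\<t>^1)) (dup (\<t>^1)) (ident (\<t>^1)) (ident (\<t>^1))"
| pb_swap: "entailed arF arP P
      (swap (\<t>^1) (\<t>^1)) (swap (\<t>^1) (\<t>^1)) (ident (\<t>^2)) (ident (\<t>^2))"
| pb_dup_dup: "entailed arF arP P
      (dup (\<t>^1) \<otimes> ident (\<t>^1)) (ident (\<t>^1) \<otimes> dup (\<t>^1)) (dup (\<t>^1)) (dup (\<t>^1))"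
| id_conf: "is_arr (conf_sig arF arP) h \<Longrightarrow>
    entailed arF arP P h (ident (tgt h)) (ident (src h)) h"
| id_obs: "is_arr (obs_sig arF P) v \<Longrightarrow>
    entailed arF arP P (ident (tgt v)) v v (ident (src v))"
| hcomp: "entailed arF arP P s1 u1 v1 r1 \<Longrightarrow> entailed arF arP P s2 v1 v2 r2 \<Longrightarrow>
    entailed arF arP P (s2 ;; s1) u1 v2 (r2 ;; r1)"
| vcomp: "entailed arF arP P s1 u1 v1 r1 \<Longrightarrow> entailed arF arP P r1 u2 v2 r2 \<Longrightarrow>
    entailed arF arP P s1 (u2 ;; u1) (v2 ;; v1) r2"
| pcomp: "entailed arF arP P s1 u1 v1 r1 \<Longrightarrow> entailed arF arP P s2 u2 v2 r2 \<Longrightarrow>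
    entailed arF arP P (s1 \<otimes> s2) (u1 \<otimes> u2) (v1 \<otimes> v2) (r1 \<otimes> r2)"

definition refutation_tile ::
  "('f \<Rightarrow> nat) \<Rightarrow> ('p \<Rightarrow> nat) \<Rightarrow> ('f, 'p) clause set \<Rightarrow>
   ('f, 'p) cop arr \<Rightarrow> ('f, 'p) oop arr \<Rightarrow> ('f, 'p) oop arr \<Rightarrow> nat \<Rightarrow> nat \<Rightarrow> bool" where
  "refutation_tile arF arP P G s \<theta> m n \<longleftrightarrow>
     entailed arF arP P G s \<theta> (box_pow m \<otimes> disch (\<t>^n))"

section \<open>The forest described by a trigger\<close>

text \<open>A node is addressed by a nonempty path: \<open>[i]\<close> is the root of the \<open>i\<close>-th tree, and
  \<open>x @ [j]\<close> is the \<open>j\<close>-th child of \<open>x\<close>.  Variables of the trigger are not nodes.\<close>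

type_synonym node = "nat list"

fun clause_at :: "('f, 'p) oop tm list \<Rightarrow> node \<Rightarrow> ('f, 'p) clause option" where
  "clause_at us [] = None"
| "clause_at us (i # x) =
     (if i < length us then
        (case us ! i of
           Op (OClause c) ws \<Rightarrow> (if x = [] then Some c else clause_at ws x)
         | _ \<Rightarrow> None)
      else None)"

definition forest_nodes :: "('f, 'p) oop arr \<Rightarrow> node set" where
  "forest_nodes s = dom (clause_at (tms s))"

definition node_clause :: "('f, 'p) oop arr \<Rightarrow> node \<Rightarrow> ('f, 'p) clause" where
  "node_clause s x = the (clause_at (tms s) x)"

definition forest_order :: "('f, 'p) oop arr \<Rightarrow> (node \<times> node) set" where
  "forest_order s = {(x, y). x \<in> forest_nodes s \<and> y \<in> forest_nodes s \<and> prefix x y}"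

section \<open>SLD-resolution\<close>

definition subst_atom :: "(nat \<Rightarrow> 'f tm) \<Rightarrow> ('f, 'p) atom \<Rightarrow> ('f, 'p) atom" where
  "subst_atom \<sigma> A = (fst A, map (subst \<sigma>) (snd A))"

definition is_mgu :: "(nat \<Rightarrow> 'f tm) \<Rightarrow> ('f, 'p) atom \<Rightarrow> ('f, 'p) atom \<Rightarrow> bool" where
  "is_mgu \<sigma> A B \<longleftrightarrow> subst_atom \<sigma> A = subst_atom \<sigma> B \<and>
     (\<forall>\<tau>. subst_atom \<tau> A = subst_atom \<tau> B \<longrightarrow> (\<exists>\<delta>. \<forall>i. \<tau> i = subst \<delta> (\<sigma> i)))"

text \<open>A state \<open>(V, \<alpha>, gs)\<close> consists of the variables \<open>V\<close> used so far, the composition \<open>\<alpha>\<close> of the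
  mgus computed so far, and the current goal, in which every atom is tagged with the address of
  the forest node it corresponds to.  The \<open>j\<close>-th atom of the body of the clause applied to the
  subgoal of node \<open>x\<close> becomes the subgoal of the \<open>j\<close>-th child of \<open>x\<close>.\<close>

type_synonym ('f, 'p) sld_state =
  "nat set \<times> (nat \<Rightarrow> 'f tm) \<times> (node \<times> ('f, 'p) atom) list"

inductive sld_step ::
  "node \<Rightarrow> ('f, 'p) clause \<Rightarrow> ('f, 'p) sld_state \<Rightarrow> ('f, 'p) sld_state \<Rightarrow> bool" where
  "inj_on \<rho> {..<nvars c} \<Longrightarrow> W = \<rho> ` {..<nvars c} \<Longrightarrow> W \<inter> V = {} \<Longrightarrow>
   is_mgu \<sigma> A (subst_atom (Var \<circ> \<rho>) (head c)) \<Longrightarrow>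
   bs = map (\<lambda>j. (x @ [j], subst_atom (Var \<circ> \<rho>) (body c ! j))) [0..<length (body c)] \<Longrightarrow>
   sld_step x c
     (V, \<alpha>, gs @ (x, A) # hs)
     (V \<union> W \<union> (\<Union>i \<in> V \<union> W. vars (\<sigma> i)),
      \<lambda>i. subst \<sigma> (\<alpha> i),
      map (apsnd (subst_atom \<sigma>)) (gs @ bs @ hs))"

text \<open>Successive steps, applying to the subgoal of each listed node the clause that labels it.\<close>

inductive sld_run ::
  "(node \<Rightarrow> ('f, 'p) clause) \<Rightarrow> node list \<Rightarrow> ('f, 'p) sld_state \<Rightarrow> ('f, 'p) sld_state \<Rightarrow> bool"
  for lab :: "node \<Rightarrow> ('f, 'p) clause" where
  "sld_run lab [] S S"
| "sld_step x (lab x) S S' \<Longrightarrow> sld_run lab xs S' S'' \<Longrightarrow> sld_run lab (x # xs) S S''"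

text \<open>An empty subgoal contributes no atom to the initial goal.\<close>

definition sld_init :: "nat \<Rightarrow> ('f, 'p) atom option list \<Rightarrow> ('f, 'p) sld_state" where
  "sld_init n gs =
     ({..<n}, Var,
      map (\<lambda>i. ([i], the (gs ! i))) (filter (\<lambda>i. gs ! i \<noteq> None) [0..<length gs]))"

text \<open>Answer substitutions for \<open>Var 0, \<dots>, Var (n - 1)\<close> are compared up to renaming.\<close>

definition same_answer :: "nat \<Rightarrow> 'f tm list \<Rightarrow> (nat \<Rightarrow> 'f tm) \<Rightarrow> bool" where
  "same_answer n \<theta> \<alpha> \<longleftrightarrow> length \<theta> = n \<and>
     (\<exists>\<pi>. bij \<pi> \<and> (\<forall>i < n. \<theta> ! i = subst (Var \<circ> \<pi>) (\<alpha> i)))"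

end

theory Submission
  imports Defs
begin

text \<open>Interpret the sort \<open>\<t>\<close> by terms and the sort \<open>\<p>\<close> by partial derivations, that is trees of
  clauses whose leaves are atoms or \<open>\<box>\<close>, preordered by replacing an atom by a clause instance
  with that head and its body atoms as children.  Configurations and observations become monotone
  maps, and every entailed tile \<open>\<langle>s, u, v, r\<rangle>\<close> becomes a lax weak pullback: \<open>s (v d) \<le> u (r d)\<close> for
  all \<open>d\<close>, and \<open>s a \<le> u b\<close> implies \<open>a \<le> v d\<close> and \<open>r d \<le> b\<close> for some \<open>d\<close>.  This property
  holds for the basic tiles and is stable under pasting.  For a refutation tile it says that the
  substitutions under which the forest of the trigger is a refutation of the goal are exactly the
  instances of \<open>\<theta>\<close>.  On the other side, a resolution step with a most general unifier does not
  change the set of substitutions that can still be completed along the forest, so at the end of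
  any run these are exactly the instances of the computed answer \<open>\<alpha>\<close>.  Hence \<open>\<theta>\<close> and \<open>\<alpha>\<close> are
  instances of each other, which makes them equal up to renaming.\<close>

section \<open>Substitutions and unification\<close>

lemma subst_cong: "(\<And>i. i \<in> vars t \<Longrightarrow> \<sigma> i = \<tau> i) \<Longrightarrow> subst \<sigma> t = subst \<tau> t"
  by (induction t) auto

lemma subst_Var [simp]: "subst Var t = t"
  by (induction t) (auto simp: map_idI)

lemma subst_subst: "subst \<tau> (subst \<sigma> t) = subst (\<lambda>i. subst \<tau> (\<sigma> i)) t"
  by (induction t) auto

lemma subst_eq_on_vars: "subst \<sigma> t = subst \<tau> t \<Longrightarrow> i \<in> vars t \<Longrightarrow> \<sigma> i = \<tau> i"
  by (induction t) auto

lemma vars_subst: "vars (subst \<sigma> t) = (\<Union>i \<in> vars t. vars (\<sigma> i))"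
  by (induction t) auto

lemma finite_vars [simp]: "finite (vars t)"
  by (induction t) auto

section \<open>Most general unifiers of finite systems of equations\<close>

definition unifier :: "(nat \<Rightarrow> 'f tm) \<Rightarrow> ('f tm \<times> 'f tm) list \<Rightarrow> bool" where
  "unifier \<sigma> E \<longleftrightarrow> (\<forall>(t, u) \<in> set E. subst \<sigma> t = subst \<sigma> u)"

definition mgu_of :: "(nat \<Rightarrow> 'f tm) \<Rightarrow> ('f tm \<times> 'f tm) list \<Rightarrow> bool" where
  "mgu_of \<sigma> E \<longleftrightarrow> unifier \<sigma> E \<and> (\<forall>\<tau>. unifier \<tau> E \<longrightarrow> (\<exists>\<delta>. \<forall>i. \<tau> i = subst \<delta> (\<sigma> i)))"

definition eqs_vars :: "('f tm \<times> 'f tm) list \<Rightarrow> nat set" where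
  "eqs_vars E = (\<Union>(t, u) \<in> set E. vars t \<union> vars u)"

primrec tm_size :: "'f tm \<Rightarrow> nat" where
  "tm_size (Var i) = 1"
| "tm_size (Op g us) = Suc (sum_list (map tm_size us))"

definition eqs_size :: "('f tm \<times> 'f tm) list \<Rightarrow> nat" where
  "eqs_size E = sum_list (map (\<lambda>(t, u). tm_size t + tm_size u) E)"

lemma tm_size_pos [simp]: "0 < tm_size t"
  by (cases t) auto

lemma tm_size_subst_var: "i \<in> vars t \<Longrightarrow> tm_size (\<sigma> i) \<le> tm_size (subst \<sigma> t)"
proof (induction t)
  case (Op g us)
  then obtain u where u: "u \<in> set us" "i \<in> vars u" by auto
  then have "tm_size (\<sigma> i) \<le> tm_size (subst \<sigma> u)" using Op.IH by blast
  also have "\<dots> \<le> sum_list (map (tm_size \<circ> subst \<sigma>) us)"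
    using u(1) by (simp add: member_le_sum_list)
  finally show ?case by simp
qed simp

text \<open>The image of \<open>i\<close> is a proper subterm of the image of \<open>t\<close>, so
  it has smaller size.\<close>

lemma occurs_check:
  assumes "i \<in> vars t" "t \<noteq> Var i"
  shows "\<sigma> i \<noteq> subst \<sigma> t"
proof (cases t)
  case (Var j)
  then show ?thesis using assms by simp
next
  case (Op g us)
  then obtain u where u: "u \<in> set us" "i \<in> vars u" using assms(1) by auto
  then have "tm_size (\<sigma> i) \<le> tm_size (subst \<sigma> u)" by (rule_tac tm_size_subst_var)
  also have "\<dots> \<le> sum_list (map (tm_size \<circ> subst \<sigma>) us)"
    using u(1) by (simp add: member_le_sum_list)
  also have "\<dots> < tm_size (subst \<sigma> t)" using Op by simp
  finally show ?thesis by auto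
qed

lemma unifier_Cons [simp]: "unifier \<sigma> ((t, u) # E) \<longleftrightarrow> subst \<sigma> t = subst \<sigma> u \<and> unifier \<sigma> E"
  by (simp add: unifier_def)

lemma unifier_append [simp]: "unifier \<sigma> (E @ E') \<longleftrightarrow> unifier \<sigma> E \<and> unifier \<sigma> E'"
  by (auto simp: unifier_def)

lemma unifier_zip:
  "length us = length vs \<Longrightarrow> unifier \<sigma> (zip us vs) \<longleftrightarrow> map (subst \<sigma>) us = map (subst \<sigma>) vs"
  by (induction us vs rule: list_induct2) (auto simp: unifier_def)

lemma finite_eqs_vars [simp]: "finite (eqs_vars E)"
  by (auto simp: eqs_vars_def)

lemma eqs_size_zip:
  "length us = length vs \<Longrightarrow>
    eqs_size (zip us vs) = sum_list (map tm_size us) + sum_list (map tm_size vs)"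
  by (induction us vs rule: list_induct2) (auto simp: eqs_size_def)

lemma eqs_vars_zip: "eqs_vars (zip us vs) \<subseteq> \<Union> (vars ` set us) \<union> \<Union> (vars ` set vs)"
  by (fastforce simp: eqs_vars_def dest: set_zip_leftD set_zip_rightD)

text \<open>Replacing \<open>i\<close> by \<open>t\<close> removes \<open>i\<close> from the
  remaining equations, because \<open>i\<close> does not occur in \<open>t\<close>. The system
  obtained has fewer variables, so \<open>IH\<close>, which stands for the induction hypothesis of
  \<open>unifiable_mgu_of\<close>, gives an mgu of it; applying that mgu after
  \<open>Var(i := t)\<close> yields an mgu of the whole system.\<close>

lemma mgu_of_eliminate:
  fixes E :: "('f tm \<times> 'f tm) list"
  assumes "i \<notin> vars t" "subst \<tau> (Var i) = subst \<tau> t" "unifier \<tau> E"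
    and IH: "\<And>(E' :: ('f tm \<times> 'f tm) list) \<tau>. card (eqs_vars E') < card (insert i (vars t \<union> eqs_vars E)) \<Longrightarrow>
      unifier \<tau> E' \<Longrightarrow> \<exists>\<sigma>. mgu_of \<sigma> E'"
  shows "\<exists>\<sigma>. mgu_of \<sigma> ((Var i, t) # E)"
proof -
  define \<beta> where "\<beta> = Var(i := t)"
  define E' where "E' = map (\<lambda>(a, b). (subst \<beta> a, subst \<beta> b)) E"
  \<comment> \<open>A substitution that solves the eliminated equation does not notice the
    elimination; hence it unifies \<open>E'\<close> iff it unifies \<open>E\<close>.\<close>
  have absorb: "subst \<tau> (subst \<beta> u) = subst \<tau> u" if "subst \<tau> (Var i) = subst \<tau> t" for \<tau> u
    unfolding subst_subst by (rule subst_cong) (use that in \<open>auto simp: \<beta>_def\<close>)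
  have unif: "unifier \<tau> E' \<longleftrightarrow> unifier \<tau> E" if "subst \<tau> (Var i) = subst \<tau> t" for \<tau>
    using absorb[OF that] by (fastforce simp: unifier_def E'_def)
  have "vars (subst \<beta> u) \<subseteq> vars t \<union> (vars u - {i})" for u
    by (auto simp: vars_subst \<beta>_def split: if_splits)
  then have "eqs_vars E' \<subseteq> vars t \<union> (eqs_vars E - {i})"
    by (fastforce simp: eqs_vars_def E'_def)
  then have "eqs_vars E' \<subset> insert i (vars t \<union> eqs_vars E)"
    using assms(1) by blast
  then have "card (eqs_vars E') < card (insert i (vars t \<union> eqs_vars E))"
    by (intro psubset_card_mono) auto
  then obtain \<sigma> where \<sigma>: "mgu_of \<sigma> E'"
    using IH unif assms(2,3) by blast
  define \<sigma>' where "\<sigma>' = (\<lambda>j. subst \<sigma> (\<beta> j))"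
  have t: "subst \<beta> t = t"
  proof -
    have "subst \<beta> t = subst Var t"
      by (rule subst_cong) (use assms(1) in \<open>auto simp: \<beta>_def\<close>)
    then show ?thesis by simp
  qed
  have \<sigma>'_subst: "subst \<sigma>' u = subst \<sigma> (subst \<beta> u)" for u
    by (simp add: \<sigma>'_def subst_subst)
  have "unifier \<sigma>' ((Var i, t) # E)"
    using \<sigma> t by (fastforce simp: mgu_of_def \<sigma>'_subst unifier_def E'_def \<beta>_def)
  moreover have "\<exists>\<delta>. \<forall>j. \<tau> j = subst \<delta> (\<sigma>' j)" if "unifier \<tau> ((Var i, t) # E)" for \<tau>
  proof -
    have eq: "subst \<tau> (Var i) = subst \<tau> t" and "unifier \<tau> E'"
      using that unif by auto
    then obtain \<delta> where \<delta>: "\<And>j. \<tau> j = subst \<delta> (\<sigma> j)"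
      using \<sigma> by (auto simp: mgu_of_def)
    have "subst \<tau> u = subst \<delta> (subst \<sigma> u)" for u
      unfolding subst_subst by (rule subst_cong) (rule \<delta>)
    then have "\<tau> j = subst \<delta> (\<sigma>' j)" for j
      using absorb[OF eq, of "Var j"] by (simp add: \<sigma>'_def)
    then show ?thesis by blast
  qed
  ultimately show ?thesis by (auto simp: mgu_of_def)
qed

lemma mgu_of_swap: "mgu_of \<sigma> ((t, u) # E) \<longleftrightarrow> mgu_of \<sigma> ((u, t) # E)"
  by (auto simp: mgu_of_def)

text \<open>The classical unification procedure as an induction on the lexicographic pair of the
  number of variables and the total size. Eliminating a variable lowers the first component;
  deleting a trivial equation or decomposing two applications lowers the second and introduces no
  variable.\<close>

lemma unifiable_mgu_of:
  fixes E :: "('f tm \<times> 'f tm) list"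
  shows "unifier \<tau> E \<Longrightarrow> \<exists>\<sigma>. mgu_of \<sigma> E"
proof (induction "(card (eqs_vars E), eqs_size E)" arbitrary: E \<tau>
    rule: wf_induct_rule[OF wf_lex_prod[OF wf_less_than wf_less_than]])
  case 1
  have IH: "\<exists>\<sigma>. mgu_of \<sigma> E'"
    if "card (eqs_vars E') < card (eqs_vars E) \<or>
      card (eqs_vars E') = card (eqs_vars E) \<and> eqs_size E' < eqs_size E"
      "unifier \<tau> E'" for E' :: "('f tm \<times> 'f tm) list" and \<tau>
    using that by (intro 1(1)) auto
  \<comment> \<open>The form of the hypothesis for deletion and decomposition: without new
    variables, a smaller size suffices.\<close>
  have IH': "\<exists>\<sigma>. mgu_of \<sigma> E'"
    if "eqs_vars E' \<subseteq> eqs_vars E" "eqs_size E' < eqs_size E" "unifier \<tau> E'" for E' :: "('f tm \<times> 'f tm) list" and \<tau>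
    using IH[OF _ that(3)] that(2) card_mono[OF finite_eqs_vars that(1)] by fastforce
  show ?case
  proof (cases E)
    case Nil
    have "mgu_of Var E" using Nil by (auto simp: mgu_of_def unifier_def)
    then show ?thesis by blast
  next
    case (Cons e E')
    obtain t u where e: "e = (t, u)" by force
    have eq: "subst \<tau> t = subst \<tau> u" and E': "unifier \<tau> E'"
      using 1(2) Cons e by auto
    \<comment> \<open>Both orientations of an equation with a variable side are handled at once; if
      \<open>w\<close> is that same variable, the equation is trivial and is dropped.\<close>
    have elim: "\<exists>\<sigma>. mgu_of \<sigma> ((Var i, w) # E')"
      if "(t, u) = (Var i, w) \<or> (t, u) = (w, Var i)" for i w
    proof (cases "w = Var i")
      case True
      have "\<exists>\<sigma>. mgu_of \<sigma> E'"
        using E' Cons e by (intro IH') (auto simp: eqs_vars_def eqs_size_def)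
      then show ?thesis using True by (simp add: mgu_of_def)
    next
      case False
      have eq': "subst \<tau> (Var i) = subst \<tau> w" using that eq by auto
      then have "i \<notin> vars w" using occurs_check[of i w \<tau>] False by auto
      moreover have "eqs_vars E = insert i (vars w \<union> eqs_vars E')"
        using Cons e that by (auto simp: eqs_vars_def)
      ultimately show ?thesis
        using eq' E' IH by (intro mgu_of_eliminate) auto
    qed
    show ?thesis
    proof (cases t)
      case (Var i)
      then show ?thesis using elim Cons e by auto
    next
      case t: (Op f us)
      show ?thesis
      proof (cases u)
        case (Var i)
        then show ?thesis using elim Cons e mgu_of_swap by blast
      next
        case u: (Op g vs)
        have fg: "f = g" and args: "map (subst \<tau>) us = map (subst \<tau>) vs"
          using eq t u by auto
        have len: "length us = length vs" using args by (metis length_map)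
        have same: "unifier \<sigma> (zip us vs @ E') \<longleftrightarrow> unifier \<sigma> E" for \<sigma>
          using Cons e t u fg unifier_zip[OF len] by simp
        have "\<exists>\<sigma>. mgu_of \<sigma> (zip us vs @ E')"
        proof (rule IH')
          show "eqs_vars (zip us vs @ E') \<subseteq> eqs_vars E"
            using eqs_vars_zip[of us vs] Cons e t u by (auto simp: eqs_vars_def)
          show "eqs_size (zip us vs @ E') < eqs_size E"
            using eqs_size_zip[OF len] Cons e t u by (auto simp: eqs_size_def)
          show "unifier \<tau> (zip us vs @ E')" using same 1(2) by blast
        qed
        then show ?thesis unfolding mgu_of_def same .
      qed
    qed
  qed
qed

lemma unifiable_is_mgu:
  assumes "subst_atom \<tau> A = subst_atom \<tau> B"
  shows "\<exists>\<sigma>. is_mgu \<sigma> A B"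
proof -
  have len: "length (snd A) = length (snd B)" and fst: "fst A = fst B"
    using assms by (auto simp: subst_atom_def dest: map_eq_imp_length_eq)
  have *: "unifier \<sigma> (zip (snd A) (snd B)) \<longleftrightarrow> subst_atom \<sigma> A = subst_atom \<sigma> B" for \<sigma>
    using unifier_zip[OF len] fst by (auto simp: subst_atom_def)
  then obtain \<sigma> where "mgu_of \<sigma> (zip (snd A) (snd B))"
    using unifiable_mgu_of assms by blast
  then show ?thesis by (auto simp: is_mgu_def mgu_of_def *)
qed

section \<open>Answers that are instances of each other agree up to renaming\<close>

lemma inj_on_extends_to_bij:
  fixes f :: "'a \<Rightarrow> 'a"
  assumes "finite A" "inj_on f A"
  obtains \<pi> where "bij \<pi>" "\<And>a. a \<in> A \<Longrightarrow> \<pi> a = f a"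
proof -
  \<comment> \<open>\<open>A\<close> and its image have equally many elements, so their complements
    in the finite set \<open>B\<close> can be matched by a bijection \<open>g\<close>. Then
    \<open>f\<close> on \<open>A\<close>, \<open>g\<close> on the rest of \<open>B\<close> and the
    identity outside \<open>B\<close> form a permutation.\<close>
  define B where "B = A \<union> f ` A"
  have fin: "finite B" using assms(1) by (simp add: B_def)
  have "card (B - A) = card (B - f ` A)"
    using assms by (simp add: B_def card_Diff_subset card_image)
  then obtain g where g: "bij_betw g (B - A) (B - f ` A)"
    using fin finite_same_card_bij by (metis finite_Diff)
  define h where "h a = (if a \<in> A then f a else g a)" for a
  have "bij_betw h A (f ` A)"
    using assms(2) by (auto simp: h_def bij_betw_def inj_on_def)
  moreover have "bij_betw h (B - A) (B - f ` A)"
    using g by (rule bij_betw_cong[THEN iffD1, rotated]) (simp add: h_def)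
  ultimately have "bij_betw h (A \<union> (B - A)) (f ` A \<union> (B - f ` A))"
    by (rule bij_betw_combine) auto
  then have h: "bij_betw h B B"
    by (simp add: B_def Un_ac)
  define \<pi> where "\<pi> a = (if a \<in> B then h a else a)" for a
  have "bij_betw \<pi> B B" using h by (simp add: \<pi>_def cong: bij_betw_cong)
  moreover have "bij_betw \<pi> (- B) (- B)"
    by (auto simp: \<pi>_def bij_betw_def inj_on_def)
  ultimately have "bij_betw \<pi> (B \<union> - B) (B \<union> - B)"
    by (rule bij_betw_combine) auto
  then have "bij \<pi>" by (simp add: Compl_partition)
  moreover have "\<pi> a = f a" if "a \<in> A" for a
    using that by (simp add: \<pi>_def h_def B_def)
  ultimately show ?thesis using that by blast
qed

lemma subst_eq_Var: "subst \<sigma> t = Var i \<Longrightarrow> \<exists>j. t = Var j"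
  by (cases t) auto

text \<open>On the variables of \<alpha> the substitution \<epsilon> undoes \<delta>. Hence \<delta>
  sends these variables to variables, and injectively so; extending this finite injection to a
  permutation gives the renaming.\<close>

lemma same_answer_if_mutual_instances:
  assumes "length \<theta> = n"
    and \<delta>: "\<And>i. i < n \<Longrightarrow> \<theta> ! i = subst \<delta> (\<alpha> i)"
    and \<epsilon>: "\<And>i. i < n \<Longrightarrow> \<alpha> i = subst \<epsilon> (\<theta> ! i)"
  shows "same_answer n \<theta> \<alpha>"
proof -
  define A where "A = (\<Union>i < n. vars (\<alpha> i))"
  have inv: "subst \<epsilon> (\<delta> j) = Var j" if j: "j \<in> A" for j
  proof -
    obtain i where i: "i < n" "j \<in> vars (\<alpha> i)" using j by (auto simp: A_def)
    have "subst (\<lambda>j. subst \<epsilon> (\<delta> j)) (\<alpha> i) = subst \<epsilon> (subst \<delta> (\<alpha> i))"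
      by (rule subst_subst[symmetric])
    also have "\<dots> = subst \<epsilon> (\<theta> ! i)" by (rule arg_cong[OF \<delta>[OF i(1), symmetric]])
    also have "\<dots> = subst Var (\<alpha> i)" unfolding subst_Var by (rule \<epsilon>[OF i(1), symmetric])
    finally have "subst (\<lambda>j. subst \<epsilon> (\<delta> j)) (\<alpha> i) = subst Var (\<alpha> i)" .
    from subst_eq_on_vars[OF this i(2)] show ?thesis .
  qed
  then have "\<exists>k. \<delta> j = Var k" if "j \<in> A" for j
    using that subst_eq_Var by blast
  then obtain f where f: "\<And>j. j \<in> A \<Longrightarrow> \<delta> j = Var (f j)" by metis
  have "inj_on f A"
  proof (rule inj_onI)
    fix j k assume "j \<in> A" "k \<in> A" "f j = f k"
    then have "Var j = (Var k :: 'a tm)" using inv[of j] inv[of k] f by simp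
    then show "j = k" by simp
  qed
  moreover have "finite A" by (simp add: A_def)
  ultimately obtain \<pi> where \<pi>: "bij \<pi>" "\<And>j. j \<in> A \<Longrightarrow> \<pi> j = f j"
    using inj_on_extends_to_bij by blast
  have "\<theta> ! i = subst (Var \<circ> \<pi>) (\<alpha> i)" if "i < n" for i
  proof -
    have "vars (\<alpha> i) \<subseteq> A" using that by (auto simp: A_def)
    then show ?thesis unfolding \<delta>[OF that] by (intro subst_cong) (auto simp: f \<pi>(2))
  qed
  then show ?thesis using assms(1) \<pi>(1) by (auto simp: same_answer_def)
qed

section \<open>A preordered algebra of partial derivations\<close>

datatype ('f, 'p) dtree =
  Goal "('f, 'p) atom" | Empty | Resolve "('f, 'p) clause" "('f, 'p) dtree list"

text \<open>Atoms are matched against clause heads and are never instantiated, since values stand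
  for already instantiated goals. One \<sigma> serves head and body, so variables local to the body
  take the same value in all children. The children may be derived further within the same
  rule.\<close>

inductive derives :: "('f, 'p) dtree \<Rightarrow> ('f, 'p) dtree \<Rightarrow> bool" where
  derives_refl: "derives x x"
| derives_Resolve: "list_all2 derives xs ys \<Longrightarrow> derives (Resolve c xs) (Resolve c ys)"
| derives_Goal: "list_all2 derives (map (\<lambda>A. Goal (subst_atom \<sigma> A)) (body c)) ys \<Longrightarrow>
    derives (Goal (subst_atom \<sigma> (head c))) (Resolve c ys)"

inductive_cases derives_ResolveE: "derives (Resolve c xs) y"
inductive_cases derives_EmptyE: "derives Empty y"
inductive_cases derives_Goal_ResolveE: "derives (Goal A) (Resolve c ys)"
inductive_cases derives_Goal_EmptyE: "derives (Goal A) Empty"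

text \<open>Apart from reflexivity, every rule ends in a \<open>Resolve\<close> node, and whatever
  is derived from such a node keeps its root clause. The second derivation can therefore be split
  along the children of the first.\<close>

lemma derives_trans: "derives x y \<Longrightarrow> derives y z \<Longrightarrow> derives x z"
proof (induction arbitrary: z rule: derives.induct)
  case (derives_refl x)
  then show ?case .
next
  case (derives_Resolve xs ys c)
  from derives_Resolve.prems show ?case
  proof (rule derives_ResolveE)
    assume "z = Resolve c ys"
    then show ?thesis
      using derives_Resolve.IH
      by (auto intro!: derives.derives_Resolve elim: list_all2_mono)
  next
    fix zs assume z: "z = Resolve c zs" and "list_all2 derives ys zs"
    then have "list_all2 derives xs zs"
      using derives_Resolve.IH by (auto simp: list_all2_conv_all_nth)
    then show ?thesis using z by (auto intro: derives.derives_Resolve)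
  qed
next
  case (derives_Goal \<sigma> c ys)
  from derives_Goal.prems show ?case
  proof (rule derives_ResolveE)
    assume "z = Resolve c ys"
    then show ?thesis
      using derives_Goal.IH
      by (auto intro!: derives.derives_Goal elim: list_all2_mono)
  next
    fix zs assume z: "z = Resolve c zs" and "list_all2 derives ys zs"
    then have "list_all2 derives (map (\<lambda>A. Goal (subst_atom \<sigma> A)) (body c)) zs"
      using derives_Goal.IH by (auto simp: list_all2_conv_all_nth)
    then show ?thesis using z by (auto intro: derives.derives_Goal)
  qed
qed

datatype ('f, 'p) val = TermV "'f tm" | ProofV "('f, 'p) dtree"

fun val_sort :: "('f, 'p) val \<Rightarrow> sort" where
  "val_sort (TermV t) = ST"
| "val_sort (ProofV d) = SP"

text \<open>The value at the wrong sort is a dummy, as it is in \<open>val_proof\<close>. Being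
  constant, the dummies keep the operations of the algebras monotone without any sort
  assumption.\<close>

fun val_term :: "('f, 'p) val \<Rightarrow> 'f tm" where
  "val_term (TermV t) = t"
| "val_term (ProofV d) = Var 0"

fun val_proof :: "('f, 'p) val \<Rightarrow> ('f, 'p) dtree" where
  "val_proof (TermV t) = Empty"
| "val_proof (ProofV d) = d"

fun val_le :: "('f, 'p) val \<Rightarrow> ('f, 'p) val \<Rightarrow> bool" where
  "val_le (TermV a) (TermV b) \<longleftrightarrow> a = b"
| "val_le (ProofV a) (ProofV b) \<longleftrightarrow> derives a b"
| "val_le _ _ \<longleftrightarrow> False"

abbreviation vals_le :: "('f, 'p) val list \<Rightarrow> ('f, 'p) val list \<Rightarrow> bool" where
  "vals_le \<equiv> list_all2 val_le"

lemma val_le_refl [simp]: "val_le x x"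
  by (cases x) (auto intro: derives_refl)

lemma val_le_trans: "val_le x y \<Longrightarrow> val_le y z \<Longrightarrow> val_le x z"
  by (cases x; cases y; cases z) (auto intro: derives_trans)

lemma vals_le_refl [simp]: "vals_le xs xs"
  by (simp add: list_all2_refl)

lemma vals_le_trans: "vals_le xs ys \<Longrightarrow> vals_le ys zs \<Longrightarrow> vals_le xs zs"
  by (rule list_all2_trans[of val_le val_le val_le]) (auto intro: val_le_trans)

lemma val_term_cong: "val_le x y \<Longrightarrow> val_term x = val_term y"
  by (cases x; cases y) auto

lemma val_proof_mono: "val_le x y \<Longrightarrow> derives (val_proof x) (val_proof y)"
  by (cases x; cases y) (auto intro: derives_refl)

lemma map_val_term_cong: "vals_le xs ys \<Longrightarrow> map val_term xs = map val_term ys"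
  by (induction rule: list_all2_induct) (auto intro: val_term_cong)

lemma map_val_proof_mono:
  "vals_le xs ys \<Longrightarrow> list_all2 derives (map val_proof xs) (map val_proof ys)"
  by (induction rule: list_all2_induct) (auto intro: val_proof_mono)

lemma val_le_TermV_sort: "val_sort x = ST \<Longrightarrow> val_le x y \<longleftrightarrow> x = y"
  by (cases x; cases y) auto

lemma val_le_sort_TermV: "val_sort y = ST \<Longrightarrow> val_le x y \<longleftrightarrow> x = y"
  by (cases x; cases y) auto

lemma TermV_val_term: "val_sort x = ST \<Longrightarrow> TermV (val_term x) = x"
  by (cases x) auto

lemma ProofV_val_proof: "val_sort x = SP \<Longrightarrow> ProofV (val_proof x) = x"
  by (cases x) auto

lemma vals_ST: "map val_sort xs = \<t>^k \<longleftrightarrow> length xs = k \<and> (\<forall>x \<in> set xs. val_sort x = ST)"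
  by (metis (no_types, lifting) in_set_replicate length_map length_replicate list.set_map
      map_replicate_const image_iff map_eq_conv)

lemma vals_SP: "map val_sort xs = \<p>^k \<longleftrightarrow> length xs = k \<and> (\<forall>x \<in> set xs. val_sort x = SP)"
  by (metis (no_types, lifting) in_set_replicate length_map length_replicate list.set_map
      map_replicate_const image_iff map_eq_conv)

lemma vals_ST_eq_map: "map val_sort xs = \<t>^k \<Longrightarrow> map TermV (map val_term xs) = xs"
  by (auto simp: vals_ST o_def TermV_val_term intro: map_idI)

lemma vals_SP_eq_map: "map val_sort xs = \<p>^k \<Longrightarrow> map ProofV (map val_proof xs) = xs"
  by (auto simp: vals_SP o_def ProofV_val_proof intro: map_idI)

lemma map_val_term_inj:
  "map val_sort xs = \<t>^k \<Longrightarrow> map val_sort ys = \<t>^k \<Longrightarrow> map val_term xs = map val_term ys \<Longrightarrow> xs = ys"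
  by (metis vals_ST_eq_map)

lemma vals_le_map_TermV: "vals_le (map TermV xs) (map TermV ys) \<longleftrightarrow> xs = ys"
  by (auto simp: list_all2_conv_all_nth intro: nth_equalityI)

lemma map_TermV_sort [simp]: "map val_sort (map TermV ts) = \<t>^(length ts)"
  unfolding vals_ST by auto

section \<open>Interpretation of arrows as monotone maps\<close>

primrec interp :: "('o \<Rightarrow> 'v list \<Rightarrow> 'v) \<Rightarrow> 'v list \<Rightarrow> 'o tm \<Rightarrow> 'v" where
  "interp I e (Var i) = e ! i"
| "interp I e (Op g us) = I g (map (interp I e) us)"

definition interp_arr :: "('o \<Rightarrow> 'v list \<Rightarrow> 'v) \<Rightarrow> 'o arr \<Rightarrow> 'v list \<Rightarrow> 'v list" where
  "interp_arr I a e = map (interp I e) (tms a)"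

text \<open>Function symbols act alike here and in \<open>obs_alg\<close>, on which the pullback
  tiles rest. On derivations, configurations only create leaves, whereas resolution is the business
  of observations.\<close>

fun conf_alg :: "('f, 'p) cop \<Rightarrow> ('f, 'p) val list \<Rightarrow> ('f, 'p) val" where
  "conf_alg (CFun f) xs = TermV (Op f (map val_term xs))"
| "conf_alg (CPred p) xs = ProofV (Goal (p, map val_term xs))"
| "conf_alg CBox xs = ProofV Empty"

fun obs_alg :: "('f, 'p) oop \<Rightarrow> ('f, 'p) val list \<Rightarrow> ('f, 'p) val" where
  "obs_alg (OFun f) xs = TermV (Op f (map val_term xs))"
| "obs_alg (OClause c) xs = ProofV (Resolve c (map val_proof xs))"

definition alg_mono :: "('o \<Rightarrow> ('f, 'p) val list \<Rightarrow> ('f, 'p) val) \<Rightarrow> bool" where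
  "alg_mono I \<longleftrightarrow> (\<forall>g xs ys. vals_le xs ys \<longrightarrow> val_le (I g xs) (I g ys))"

definition alg_sorted ::
  "'o signature \<Rightarrow> ('o \<Rightarrow> ('f, 'p) val list \<Rightarrow> ('f, 'p) val) \<Rightarrow> bool" where
  "alg_sorted S I \<longleftrightarrow> (\<forall>g \<sigma>s \<tau> xs. S g = Some (\<sigma>s, \<tau>) \<longrightarrow> val_sort (I g xs) = \<tau>)"

lemma conf_alg_mono: "alg_mono conf_alg"
  unfolding alg_mono_def
proof (intro allI impI)
  fix g and xs ys :: "('f, 'p) val list" assume "vals_le xs ys"
  then show "val_le (conf_alg g xs) (conf_alg g ys)"
    using map_val_term_cong[of xs ys] by (cases g) (auto simp: derives_refl simp del: map_eq_conv)
qed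

lemma obs_alg_mono: "alg_mono obs_alg"
  unfolding alg_mono_def
proof (intro allI impI)
  fix g and xs ys :: "('f, 'p) val list" assume "vals_le xs ys"
  then show "val_le (obs_alg g xs) (obs_alg g ys)"
    using map_val_term_cong[of xs ys]
    by (cases g) (auto dest: map_val_proof_mono intro: derives_Resolve simp del: map_eq_conv)
qed

lemma conf_alg_sorted:
  fixes arF :: "'f \<Rightarrow> nat" and arP :: "'p \<Rightarrow> nat"
  shows "alg_sorted (conf_sig arF arP) conf_alg"
  unfolding alg_sorted_def
proof (intro allI impI)
  fix g :: "('f, 'p) cop" and \<sigma>s \<tau> and xs :: "('f, 'p) val list" assume "conf_sig arF arP g = Some (\<sigma>s, \<tau>)"
  then show "val_sort (conf_alg g xs) = \<tau>" by (cases g) auto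
qed

lemma obs_alg_sorted:
  fixes arF :: "'f \<Rightarrow> nat" and P :: "('f, 'p) clause set"
  shows "alg_sorted (obs_sig arF P) obs_alg"
  unfolding alg_sorted_def
proof (intro allI impI)
  fix g :: "('f, 'p) oop" and \<sigma>s \<tau> and xs :: "('f, 'p) val list" assume "obs_sig arF P g = Some (\<sigma>s, \<tau>)"
  then show "val_sort (obs_alg g xs) = \<tau>" by (cases g) (auto split: if_splits)
qed

lemma interp_mono: "alg_mono I \<Longrightarrow> vals_le e e' \<Longrightarrow>
    (\<And>i. i \<in> vars t \<Longrightarrow> i < length e) \<Longrightarrow> val_le (interp I e t) (interp I e' t)"
proof (induction t)
  case (Var i)
  then show ?case by (auto simp: list_all2_conv_all_nth)
next
  case (Op g us)
  then have "vals_le (map (interp I e) us) (map (interp I e') us)"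
    by (fastforce simp: list_all2_conv_all_nth set_conv_nth)
  then show ?case using Op.prems(1) by (auto simp: alg_mono_def)
qed

lemma has_sort_vars: "has_sort S \<Gamma> t \<tau> \<Longrightarrow> i \<in> vars t \<Longrightarrow> i < length \<Gamma>"
  by (induction rule: has_sort.induct) (auto simp: in_set_conv_nth)

lemma interp_sort:
  assumes "alg_sorted S I" and "map val_sort e = \<Gamma>"
  shows "has_sort S \<Gamma> t \<tau> \<Longrightarrow> val_sort (interp I e t) = \<tau>"
  by (induction rule: has_sort.induct) (use assms in \<open>auto simp: alg_sorted_def\<close>)

lemma is_arr_vars: "is_arr S a \<Longrightarrow> t \<in> set (tms a) \<Longrightarrow> i \<in> vars t \<Longrightarrow> i < length (src a)"
  by (auto simp: is_arr_def in_set_conv_nth dest: has_sort_vars)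

lemma interp_arr_mono:
  assumes "alg_mono I" "is_arr S a" "map val_sort e = src a" "vals_le e e'"
  shows "vals_le (interp_arr I a e) (interp_arr I a e')"
proof -
  have "val_le (interp I e t) (interp I e' t)" if "t \<in> set (tms a)" for t
    using interp_mono[OF assms(1,4)] is_arr_vars[OF assms(2) that] arg_cong[OF assms(3), of length]
    by auto
  then show ?thesis by (auto simp: interp_arr_def list_all2_conv_all_nth)
qed

lemma interp_arr_sort:
  assumes "alg_sorted S I" "is_arr S a" "map val_sort e = src a"
  shows "map val_sort (interp_arr I a e) = tgt a"
  using assms interp_sort[OF assms(1) assms(3)]
  by (auto simp: interp_arr_def is_arr_def intro!: nth_equalityI)

text \<open>The bound on the variables is essential: beyond the end of \<open>us\<close> list lookup
  is unspecified, and looking up before or after mapping need not agree.\<close>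

lemma interp_subst:
  "(\<And>i. i \<in> vars t \<Longrightarrow> i < length us) \<Longrightarrow>
    interp I e (subst (\<lambda>i. us ! i) t) = interp I (map (interp I e) us) t"
proof (induction t)
  case (Op g ts)
  then have "map (interp I e \<circ> subst (\<lambda>i. us ! i)) ts = map (interp I (map (interp I e) us)) ts"
    by (auto simp: o_def)
  then show ?case by (simp del: map_eq_conv)
qed auto

text \<open>Functoriality of the interpretation: arrows compose by substitution, and evaluating a
  substituted term means evaluating the substituted terms first.\<close>

lemma interp_comp:
  assumes "is_arr S a" "is_arr S' b" "src b = tgt a"
  shows "interp_arr I (a ;; b) e = interp_arr I b (interp_arr I a e)"
  using is_arr_vars[OF assms(2)] assms(1,3)
  by (auto simp: interp_arr_def comp_def is_arr_def intro!: interp_subst)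

lemma interp_append_left:
  "(\<And>i. i \<in> vars t \<Longrightarrow> i < length e1) \<Longrightarrow> interp I (e1 @ e2) t = interp I e1 t"
proof (induction t)
  case (Op g ts)
  then have "map (interp I (e1 @ e2)) ts = map (interp I e1) ts" by auto
  then show ?case by (simp del: map_eq_conv)
qed (auto simp: nth_append)

lemma interp_append_right:
  "interp I (e1 @ e2) (subst (\<lambda>i. Var (length e1 + i)) t) = interp I e2 t"
proof (induction t)
  case (Op g ts)
  then have "map (interp I (e1 @ e2) \<circ> subst (\<lambda>i. Var (length e1 + i))) ts = map (interp I e2) ts"
    by (auto simp: o_def)
  then show ?case by (simp del: map_eq_conv)
qed auto

lemma interp_par:
  assumes "is_arr S a" "length e1 = length (src a)"
  shows "interp_arr I (a \<otimes> b) (e1 @ e2) = interp_arr I a e1 @ interp_arr I b e2"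
  using is_arr_vars[OF assms(1)] assms(2) interp_append_right[of I e1 e2]
  by (auto simp: interp_arr_def par_def intro!: interp_append_left)

lemma interp_ident: "length e = length \<Gamma> \<Longrightarrow> interp_arr I (ident \<Gamma>) e = e"
  by (auto simp: interp_arr_def ident_def o_def intro!: nth_equalityI)

lemma interp_ident_sorted: "map val_sort e = \<Gamma> \<Longrightarrow> interp_arr I (ident \<Gamma>) e = e"
  by (auto intro: interp_ident)

lemma interp_dup: "length e = length \<Gamma> \<Longrightarrow> interp_arr I (dup \<Gamma>) e = e @ e"
  by (auto simp: interp_arr_def dup_def o_def nth_append intro!: nth_equalityI)

lemma interp_swap:
  "length e1 = length \<Gamma> \<Longrightarrow> length e2 = length \<Delta> \<Longrightarrow> interp_arr I (swap \<Gamma> \<Delta>) (e1 @ e2) = e2 @ e1"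
  by (auto simp: interp_arr_def swap_def o_def nth_append intro!: nth_equalityI)

lemma interp_op_arr: "length e = length \<Gamma> \<Longrightarrow> interp_arr I (op_arr \<Gamma> \<tau> g) e = [I g e]"
  using interp_ident[of e \<Gamma> I] by (auto simp: interp_arr_def op_arr_def ident_def)

section \<open>Typing of arrows\<close>

lemma has_sort_subst:
  assumes "has_sort S \<Gamma> t \<tau>" "\<And>i. i < length \<Gamma> \<Longrightarrow> has_sort S \<Delta> (\<sigma> i) (\<Gamma> ! i)"
  shows "has_sort S \<Delta> (subst \<sigma> t) \<tau>"
  using assms(1)
proof (induction rule: has_sort.induct)
  case (1 i)
  then show ?case using assms(2) by simp
next
  case (2 g \<sigma>s \<tau> us)
  then show ?case by (auto intro!: has_sort.intros(2))
qed

lemma is_arr_comp: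
  assumes "is_arr S a" "is_arr S b" "src b = tgt a"
  shows "is_arr S (a ;; b)"
  using assms by (auto simp: is_arr_def comp_def intro!: has_sort_subst)

lemma is_arr_par:
  assumes "is_arr S a" "is_arr S b"
  shows "is_arr S (a \<otimes> b)"
proof -
  have "has_sort S (src a @ src b) t \<tau>" if "has_sort S (src a) t \<tau>" for t \<tau>
    using that
  proof (induction rule: has_sort.induct)
    case (1 i)
    then show ?case using has_sort.intros(1)[of i "src a @ src b" S] by (simp add: nth_append)
  qed (auto intro: has_sort.intros(2))
  moreover have "has_sort S (src a @ src b) (subst (\<lambda>i. Var (length (src a) + i)) t) \<tau>"
    if "has_sort S (src b) t \<tau>" for t \<tau>
    using that
  proof (rule has_sort_subst)
    fix i assume "i < length (src b)"
    then show "has_sort S (src a @ src b) (Var (length (src a) + i)) (src b ! i)"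
      using has_sort.intros(1)[of "length (src a) + i" "src a @ src b" S] by simp
  qed
  ultimately show ?thesis using assms by (auto simp: is_arr_def par_def nth_append)
qed

lemma is_arr_ident: "is_arr S (ident \<Gamma>)"
  by (auto simp: is_arr_def ident_def intro: has_sort.intros)

lemma is_arr_dup: "is_arr S (dup \<Gamma>)"
  by (auto simp: is_arr_def dup_def nth_append intro: has_sort.intros)

lemma is_arr_swap: "is_arr S (swap \<Gamma> \<Delta>)"
proof -
  have "has_sort S (\<Gamma> @ \<Delta>) (Var (length \<Gamma> + i)) (\<Delta> ! i)" if "i < length \<Delta>" for i
    using that has_sort.intros(1)[of "length \<Gamma> + i" "\<Gamma> @ \<Delta>" S] by simp
  moreover have "has_sort S (\<Gamma> @ \<Delta>) (Var i) (\<Gamma> ! i)" if "i < length \<Gamma>" for i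
    using that has_sort.intros(1)[of i "\<Gamma> @ \<Delta>" S] by (simp add: nth_append)
  ultimately show ?thesis by (auto simp: is_arr_def swap_def nth_append)
qed

lemma is_arr_op_arr: "S g = Some (\<Gamma>, \<tau>) \<Longrightarrow> is_arr S (op_arr \<Gamma> \<tau> g)"
  by (auto simp: is_arr_def op_arr_def intro!: has_sort.intros)

lemma has_sort_map_tm:
  assumes "\<And>g \<sigma>s \<tau>. S g = Some (\<sigma>s, \<tau>) \<Longrightarrow> S' (h g) = Some (\<sigma>s, \<tau>)"
  shows "has_sort S \<Gamma> t \<tau> \<Longrightarrow> has_sort S' \<Gamma> (map_tm h t) \<tau>"
  by (induction rule: has_sort.induct) (auto intro!: has_sort.intros assms)

lemma is_arr_subst_obs:
  assumes "\<forall>u \<in> set us. has_sort (fun_sig arF) (\<t>^n) u ST"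
  shows "is_arr (obs_sig arF P) (subst_obs n us)"
  using assms
  by (auto simp: is_arr_def subst_obs_def fun_sig_def intro!: has_sort_map_tm[of "fun_sig arF"])

lemma is_arr_goal_conf:
  assumes "\<forall>A \<in> set As. wf_atom arF arP n A"
  shows "is_arr (conf_sig arF arP) (goal_conf n (map Some As))"
proof -
  have "has_sort (conf_sig arF arP) (\<t>^n) (subgoal_tm (Some A)) SP" if "A \<in> set As" for A
  proof -
    have wf: "wf_atom arF arP n A" using assms that by blast
    obtain p us where A: "A = (p, us)" by force
    have "has_sort (conf_sig arF arP) (\<t>^n) (map_tm CFun u) ST" if "u \<in> set us" for u
      using wf that A
      by (auto simp: wf_atom_def fun_sig_def intro!: has_sort_map_tm[of "fun_sig arF"])
    then show ?thesis using wf A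
      by (auto simp: wf_atom_def intro!: has_sort.intros(2)[of _ _ "\<t>^(arP p)"])
  qed
  then show ?thesis by (auto simp: is_arr_def goal_conf_def)
qed

section \<open>Values of substitutions and goals: instantiation of terms and atoms\<close>

lemma interp_map_tm_OFun:
  "(\<And>i. i \<in> vars t \<Longrightarrow> i < length e \<and> val_sort (e ! i) = ST) \<Longrightarrow>
    interp obs_alg e (map_tm OFun t) = TermV (subst (\<lambda>i. val_term (e ! i)) t)"
proof (induction t)
  case (Op g ts)
  then have "interp obs_alg e (map_tm OFun t) = TermV (subst (\<lambda>i. val_term (e ! i)) t)"
    if "t \<in> set ts" for t
    using that by auto
  then show ?case by simp
qed (auto simp: TermV_val_term)

lemma interp_map_tm_CFun:
  "(\<And>i. i \<in> vars t \<Longrightarrow> i < length e \<and> val_sort (e ! i) = ST) \<Longrightarrow>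
    interp conf_alg e (map_tm CFun t) = TermV (subst (\<lambda>i. val_term (e ! i)) t)"
proof (induction t)
  case (Op g ts)
  then have "interp conf_alg e (map_tm CFun t) = TermV (subst (\<lambda>i. val_term (e ! i)) t)"
    if "t \<in> set ts" for t
    using that by auto
  then show ?case by simp
qed (auto simp: TermV_val_term)

lemma vars_map_tm [simp]: "vars (map_tm h t) = vars t"
  by (induction t) auto

lemma interp_subst_obs:
  assumes "is_arr S (subst_obs n us :: ('f, 'p) oop arr)" "map val_sort e = \<t>^n"
  shows "interp_arr obs_alg (subst_obs n us :: ('f, 'p) oop arr) e
    = map (\<lambda>u. TermV (subst (\<lambda>i. val_term (e ! i)) u)) us"
proof -
  have "i < length e \<and> val_sort (e ! i) = ST" if "u \<in> set us" "i \<in> vars u" for u i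
    using is_arr_vars[OF assms(1), of "map_tm OFun u" i] that assms(2)
    by (auto simp: subst_obs_def vals_ST)
  then show ?thesis
    by (auto simp: interp_arr_def subst_obs_def intro!: interp_map_tm_OFun)
qed

fun goal_tree :: "('f, 'p) atom option \<Rightarrow> ('f, 'p) dtree" where
  "goal_tree (Some A) = Goal A"
| "goal_tree None = Empty"

lemma goal_conf_vars:
  assumes "is_arr S (goal_conf n gs)" "Some A \<in> set gs" "u \<in> set (snd A)" "i \<in> vars u"
  shows "i < n"
proof -
  have "subgoal_tm (Some A) \<in> set (tms (goal_conf n gs))"
    using assms(2) unfolding goal_conf_def by (metis arr.sel(3) image_eqI list.set_map)
  moreover have "i \<in> vars (subgoal_tm (Some A))"
    using assms(3,4) by (cases A) auto
  ultimately show ?thesis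
    using is_arr_vars[OF assms(1)] by (fastforce simp: goal_conf_def)
qed

lemma interp_goal_conf:
  assumes "is_arr S (goal_conf n gs)" "map val_sort e = \<t>^n"
  shows "interp_arr conf_alg (goal_conf n gs) e
    = map (\<lambda>g. ProofV (goal_tree (map_option (subst_atom (\<lambda>i. val_term (e ! i))) g))) gs"
proof -
  have "interp conf_alg e (subgoal_tm g)
      = ProofV (goal_tree (map_option (subst_atom (\<lambda>i. val_term (e ! i))) g))"
    if "g \<in> set gs" for g
  proof (cases g)
    case (Some A)
    obtain p us where A: "A = (p, us)" by force
    have "interp conf_alg e (map_tm CFun u) = TermV (subst (\<lambda>i. val_term (e ! i)) u)"
      if "u \<in> set us" for u
    proof (rule interp_map_tm_CFun)
      fix i assume "i \<in> vars u"
      then show "i < length e \<and> val_sort (e ! i) = ST"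
        using goal_conf_vars[OF assms(1)] \<open>g \<in> set gs\<close> Some A that assms(2)
        by (fastforce simp: vals_ST)
    qed
    then show ?thesis using Some A by (simp add: subst_atom_def)
  qed simp
  then show ?thesis by (auto simp: interp_arr_def goal_conf_def)
qed

section \<open>Entailed tiles are lax weak pullbacks\<close>

definition tile_typed where
  "tile_typed arF arP P s u v r \<longleftrightarrow>
     is_arr (conf_sig arF arP) s \<and> is_arr (obs_sig arF P) u \<and>
     is_arr (obs_sig arF P) v \<and> is_arr (conf_sig arF arP) r \<and>
     tgt s = tgt u \<and> src s = tgt v \<and> src u = tgt r \<and> src v = src r"

text \<open>For a refutation tile the first conjunct makes every instance of \<theta> a solution of
  the goal, and the second makes every solution an instance of \<theta>. The factor \<open>d\<close>
  need not be unique.\<close>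

definition lax_pullback ::
  "('f, 'p) cop arr \<Rightarrow> ('f, 'p) oop arr \<Rightarrow> ('f, 'p) oop arr \<Rightarrow> ('f, 'p) cop arr \<Rightarrow> bool" where
  "lax_pullback s u v r \<longleftrightarrow>
     (\<forall>d. map val_sort d = src v \<longrightarrow>
        vals_le (interp_arr conf_alg s (interp_arr obs_alg v d))
          (interp_arr obs_alg u (interp_arr conf_alg r d))) \<and>
     (\<forall>a b. map val_sort a = src s \<longrightarrow> map val_sort b = src u \<longrightarrow>
        vals_le (interp_arr conf_alg s a) (interp_arr obs_alg u b) \<longrightarrow>
        (\<exists>d. map val_sort d = src v \<and> vals_le a (interp_arr obs_alg v d) \<and>
          vals_le (interp_arr conf_alg r d) b))"

lemma lax_pullbackI:
  assumes "\<And>d. map val_sort d = src v \<Longrightarrow>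
      vals_le (interp_arr conf_alg s (interp_arr obs_alg v d))
        (interp_arr obs_alg u (interp_arr conf_alg r d))"
    and "\<And>a b. map val_sort a = src s \<Longrightarrow> map val_sort b = src u \<Longrightarrow>
      vals_le (interp_arr conf_alg s a) (interp_arr obs_alg u b) \<Longrightarrow>
      \<exists>d. map val_sort d = src v \<and> vals_le a (interp_arr obs_alg v d) \<and>
        vals_le (interp_arr conf_alg r d) b"
  shows "lax_pullback s u v r"
  using assms unfolding lax_pullback_def by blast

lemma lax_pullbackE:
  assumes "lax_pullback s u v r" "map val_sort a = src s" "map val_sort b = src u"
    and "vals_le (interp_arr conf_alg s a) (interp_arr obs_alg u b)"
  obtains d where "map val_sort d = src v" "vals_le a (interp_arr obs_alg v d)"
    "vals_le (interp_arr conf_alg r d) b"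
  using assms unfolding lax_pullback_def by blast

lemma arr_ends [simp]:
  "src (a ;; b) = src a" "tgt (a ;; b) = tgt b"
  "src (a \<otimes> b) = src a @ src b" "tgt (a \<otimes> b) = tgt a @ tgt b"
  "src (ident \<Gamma>) = \<Gamma>" "tgt (ident \<Gamma>) = \<Gamma>"
  "src (swap \<Gamma> \<Delta>) = \<Gamma> @ \<Delta>" "tgt (swap \<Gamma> \<Delta>) = \<Delta> @ \<Gamma>"
  "src (dup \<Gamma>) = \<Gamma>" "tgt (dup \<Gamma>) = \<Gamma> @ \<Gamma>"
  "src (disch \<Gamma>) = \<Gamma>" "tgt (disch \<Gamma>) = []"
  "src (op_arr \<Gamma> \<tau> g) = \<Gamma>" "tgt (op_arr \<Gamma> \<tau> g) = [\<tau>]"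
  "src (subst_obs n us) = \<t>^n" "tgt (subst_obs n us) = \<t>^(length us)"
  "src (goal_conf n gs) = \<t>^n" "tgt (goal_conf n gs) = \<p>^(length gs)"
  "src (box_pow m) = []" "tgt (box_pow m) = \<p>^m"
  by (simp_all add: comp_def par_def ident_def swap_def dup_def disch_def op_arr_def
      subst_obs_def goal_conf_def box_pow_def)

lemmas is_arr_intros =
  is_arr_comp is_arr_par is_arr_ident is_arr_dup is_arr_swap is_arr_op_arr

text \<open>The composition rules carry no typing premises, but the arrow shared by two tiles forces
  the other boundaries to match; for horizontal composition,
  \<open>tgt s2 = tgt v1 = src s1\<close>.\<close>

lemma entailed_typed:
  assumes "logic_program arF arP P" "entailed arF arP P s u v r"
  shows "tile_typed arF arP P s u v r"
  using assms(2)
proof (induction rule: entailed.induct)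
  case (clause c p us)
  then have "wf_clause arF arP c" using assms(1) by (auto simp: logic_program_def)
  then have "length us = arP p" "\<forall>u \<in> set us. has_sort (fun_sig arF) (\<t>^(nvars c)) u ST"
    "\<forall>A \<in> set (body c). wf_atom arF arP (nvars c) A"
    using clause(2) by (auto simp: wf_clause_def wf_atom_def)
  then show ?case
    unfolding tile_typed_def using clause(1)
    by (intro conjI is_arr_op_arr is_arr_subst_obs is_arr_goal_conf; simp)
next
  case pb_swap
  show ?case by (auto simp: tile_typed_def is_arr_swap is_arr_ident numeral_2_eq_2)
next
  case (hcomp s1 u1 v1 r1 s2 v2 r2)
  then show ?case by (auto simp: tile_typed_def intro!: is_arr_comp)
next
  case (vcomp s1 u1 v1 r1 u2 v2 r2)
  then show ?case by (auto simp: tile_typed_def intro!: is_arr_comp)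
next
  case (pcomp s1 u1 v1 r1 s2 u2 v2 r2)
  then show ?case by (auto simp: tile_typed_def intro!: is_arr_par)
qed (unfold tile_typed_def, (intro conjI is_arr_intros; simp)+)

section \<open>Lax pullbacks: basic tiles and stability under pasting\<close>

lemma interp_dup_op:
  assumes "length e = n"
  shows "interp_arr I (dup (\<t>^n) ;; (ident (\<t>^n) \<otimes> op_arr (\<t>^n) ST g)) e = e @ [I g e]"
proof -
  \<comment> \<open>Typing serves only to bound the variables, so a signature giving every operator
    the arity \<open>n\<close> is good enough.\<close>
  have "is_arr (\<lambda>_. Some (\<t>^n, ST)) (ident (\<t>^n) \<otimes> op_arr (\<t>^n) ST g)"
    by (intro is_arr_intros) simp
  then show ?thesis
    using assms
    by (simp add: interp_comp[OF is_arr_dup] interp_dup interp_par[OF is_arr_ident] interp_ident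
        interp_op_arr)
qed

text \<open>Lax commutation is a single resolution step with the clause instance given by
  \<open>d\<close>. Conversely, inverting \<open>derives\<close> from a goal to a node labeled
  \<open>c\<close> recovers the instantiating substitution, which is the required factor.\<close>

lemma lax_pullback_clause:
  fixes us :: "'f tm list" and c :: "('f, 'p) clause"
  assumes hd: "head c = (p, us)" and len: "length us = k"
    and obs: "is_arr S (subst_obs (nvars c) us :: ('f, 'p) oop arr)"
    and conf: "is_arr S' (goal_conf (nvars c) (map Some (body c)))"
  shows "lax_pullback (op_arr (\<t>^k) SP (CPred p))
    (op_arr (\<p>^(length (body c))) SP (OClause c))
    (subst_obs (nvars c) us) (goal_conf (nvars c) (map Some (body c)))"
proof (rule lax_pullbackI)
  fix d :: "('f, 'p) val list"
  assume "map val_sort d = src (subst_obs (nvars c) us :: ('f, 'p) oop arr)"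
  then have d: "map val_sort d = \<t>^(nvars c)" by simp
  define \<sigma> where "\<sigma> = (\<lambda>i. val_term (d ! i))"
  have "(p, map (subst \<sigma>) us) = subst_atom \<sigma> (head c)"
    using hd by (simp add: subst_atom_def)
  moreover have "derives (Goal (subst_atom \<sigma> (head c)))
      (Resolve c (map (\<lambda>A. Goal (subst_atom \<sigma> A)) (body c)))"
    by (rule derives_Goal) (simp add: list_all2_refl derives_refl)
  ultimately show "vals_le
      (interp_arr conf_alg (op_arr (\<t>^k) SP (CPred p)) (interp_arr obs_alg (subst_obs (nvars c) us) d))
      (interp_arr obs_alg (op_arr (\<p>^(length (body c))) SP (OClause c))
        (interp_arr conf_alg (goal_conf (nvars c) (map Some (body c))) d))"
    using len by (simp add: interp_subst_obs[OF obs d] interp_goal_conf[OF conf d]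
        interp_op_arr o_def flip: \<sigma>_def)
next
  fix a b :: "('f, 'p) val list"
  assume "map val_sort a = src (op_arr (\<t>^k) SP (CPred p) :: ('f, 'p) cop arr)"
    and "map val_sort b = src (op_arr (\<p>^(length (body c))) SP (OClause c) :: ('f, 'p) oop arr)"
    and le: "vals_le (interp_arr conf_alg (op_arr (\<t>^k) SP (CPred p)) a)
      (interp_arr obs_alg (op_arr (\<p>^(length (body c))) SP (OClause c)) b)"
  then have a: "map val_sort a = \<t>^k" and b: "map val_sort b = \<p>^(length (body c))"
    by auto
  have "derives (Goal (p, map val_term a)) (Resolve c (map val_proof b))"
    using le a b by (simp add: interp_op_arr vals_ST vals_SP)
  then obtain \<sigma> where \<sigma>: "(p, map val_term a) = subst_atom \<sigma> (head c)"
    and body: "list_all2 derives (map (\<lambda>A. Goal (subst_atom \<sigma> A)) (body c)) (map val_proof b)"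
    by (auto elim: derives_Goal_ResolveE)
  \<comment> \<open>The values of \<sigma> on the clause variables; by typing, head and body contain
    no others.\<close>
  define d where "d = map (\<lambda>i. TermV (\<sigma> i) :: ('f, 'p) val) [0..<nvars c]"
  have d: "map val_sort d = \<t>^(nvars c)" unfolding vals_ST by (auto simp: d_def)
  have d_subst: "subst (\<lambda>i. val_term (d ! i)) t = subst \<sigma> t"
    if "\<And>i. i \<in> vars t \<Longrightarrow> i < nvars c" for t
    by (rule subst_cong) (use that in \<open>auto simp: d_def\<close>)
  have "subst (\<lambda>i. val_term (d ! i)) u = subst \<sigma> u" if "u \<in> set us" for u
    using is_arr_vars[OF obs, of "map_tm OFun u"] that
    by (intro d_subst) (auto simp: subst_obs_def)
  then have "interp_arr obs_alg (subst_obs (nvars c) us) d = map TermV (map val_term a)"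
    using \<sigma> hd by (simp add: interp_subst_obs[OF obs d] subst_atom_def)
  then have "interp_arr obs_alg (subst_obs (nvars c) us) d = a"
    by (simp only: vals_ST_eq_map[OF a])
  moreover have "subst_atom (\<lambda>i. val_term (d ! i)) A = subst_atom \<sigma> A" if "A \<in> set (body c)" for A
    using goal_conf_vars[OF conf, of A] that unfolding subst_atom_def
    by (auto intro!: d_subst)
  then have "interp_arr conf_alg (goal_conf (nvars c) (map Some (body c))) d
      = map ProofV (map (\<lambda>A. Goal (subst_atom \<sigma> A)) (body c))"
    by (simp add: interp_goal_conf[OF conf d])
  then have "vals_le (interp_arr conf_alg (goal_conf (nvars c) (map Some (body c))) d)
      (map ProofV (map val_proof b))"
    using body by (simp only: list_all2_map1 list_all2_map2 val_le.simps)
  then have "vals_le (interp_arr conf_alg (goal_conf (nvars c) (map Some (body c))) d) b"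
    by (simp only: vals_SP_eq_map[OF b])
  ultimately show "\<exists>d. map val_sort d = src (subst_obs (nvars c) us :: ('f, 'p) oop arr) \<and>
      vals_le a (interp_arr obs_alg (subst_obs (nvars c) us) d) \<and>
      vals_le (interp_arr conf_alg (goal_conf (nvars c) (map Some (body c))) d) b"
    using d by (intro exI[of _ d]) simp
qed

text \<open>The two lax squares paste by monotonicity of \<open>s1\<close>. For the factor, tile 1
  yields \<open>d1\<close>, which is then the upper bound handed to tile 2; monotonicity of
  \<open>r1\<close> transports the resulting bound below \<open>b\<close>.\<close>

lemma lax_pullback_hcomp:
  assumes "tile_typed arF arP P s1 u1 v1 r1" "tile_typed arF arP P s2 v1 v2 r2"
    and 1: "lax_pullback s1 u1 v1 r1" and 2: "lax_pullback s2 v1 v2 r2"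
  shows "lax_pullback (s2 ;; s1) u1 v2 (r2 ;; r1)"
proof -
  note ty = assms(1,2)[unfolded tile_typed_def]
  have comps: "interp_arr conf_alg (s2 ;; s1) a = interp_arr conf_alg s1 (interp_arr conf_alg s2 a)"
    "interp_arr conf_alg (r2 ;; r1) a = interp_arr conf_alg r1 (interp_arr conf_alg r2 a)" for a
    using ty by (auto intro!: interp_comp)
  note obs = interp_arr_sort[OF obs_alg_sorted[of arF P]]
  note conf = interp_arr_sort[OF conf_alg_sorted[of arF arP]]
  note mono = interp_arr_mono[OF conf_alg_mono, where S = "conf_sig arF arP"]
  show ?thesis
  proof (rule lax_pullbackI)
    fix d :: "('a, 'b) val list" assume d: "map val_sort d = src v2"
    have "vals_le (interp_arr conf_alg s2 (interp_arr obs_alg v2 d))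
        (interp_arr obs_alg v1 (interp_arr conf_alg r2 d))"
      using 2 d by (simp add: lax_pullback_def)
    then have "vals_le (interp_arr conf_alg s1 (interp_arr conf_alg s2 (interp_arr obs_alg v2 d)))
        (interp_arr conf_alg s1 (interp_arr obs_alg v1 (interp_arr conf_alg r2 d)))"
      using ty d by (intro mono) (simp_all add: obs conf)
    moreover have "vals_le (interp_arr conf_alg s1 (interp_arr obs_alg v1 (interp_arr conf_alg r2 d)))
        (interp_arr obs_alg u1 (interp_arr conf_alg r1 (interp_arr conf_alg r2 d)))"
      using 1 d ty by (simp add: lax_pullback_def conf)
    ultimately show "vals_le (interp_arr conf_alg (s2 ;; s1) (interp_arr obs_alg v2 d))
        (interp_arr obs_alg u1 (interp_arr conf_alg (r2 ;; r1) d))"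
      unfolding comps by (rule vals_le_trans)
  next
    fix a b :: "('a, 'b) val list"
    assume a: "map val_sort a = src (s2 ;; s1)" and b: "map val_sort b = src u1"
      and le: "vals_le (interp_arr conf_alg (s2 ;; s1) a) (interp_arr obs_alg u1 b)"
    have "map val_sort (interp_arr conf_alg s2 a) = src s1" using ty a conf[of s2 a] by simp
    from lax_pullbackE[OF 1 this b le[unfolded comps]]
    obtain d1 where d1: "map val_sort d1 = src v1"
      "vals_le (interp_arr conf_alg s2 a) (interp_arr obs_alg v1 d1)"
      "vals_le (interp_arr conf_alg r1 d1) b" .
    from lax_pullbackE[OF 2 _ d1(1,2)] a
    obtain d where d: "map val_sort d = src v2" "vals_le a (interp_arr obs_alg v2 d)"
      "vals_le (interp_arr conf_alg r2 d) d1" by auto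
    have "vals_le (interp_arr conf_alg r1 (interp_arr conf_alg r2 d)) (interp_arr conf_alg r1 d1)"
      using ty d by (intro mono) (simp_all add: conf)
    then have "vals_le (interp_arr conf_alg (r2 ;; r1) d) b"
      using d1(3) unfolding comps by (rule vals_le_trans)
    then show "\<exists>d. map val_sort d = src v2 \<and> vals_le a (interp_arr obs_alg v2 d) \<and>
        vals_le (interp_arr conf_alg (r2 ;; r1) d) b"
      using d by blast
  qed
qed

text \<open>Dual to horizontal pasting: now the factor \<open>d1\<close> of tile 1 is the lower
  argument handed to tile 2, and the maps whose monotonicity is used are the observations
  \<open>u1\<close> and \<open>v1\<close>.\<close>

lemma lax_pullback_vcomp:
  assumes "tile_typed arF arP P s1 u1 v1 r1" "tile_typed arF arP P r1 u2 v2 r2"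
    and 1: "lax_pullback s1 u1 v1 r1" and 2: "lax_pullback r1 u2 v2 r2"
  shows "lax_pullback s1 (u2 ;; u1) (v2 ;; v1) r2"
proof -
  note ty = assms(1,2)[unfolded tile_typed_def]
  have comps: "interp_arr obs_alg (u2 ;; u1) a = interp_arr obs_alg u1 (interp_arr obs_alg u2 a)"
    "interp_arr obs_alg (v2 ;; v1) a = interp_arr obs_alg v1 (interp_arr obs_alg v2 a)" for a
    using ty by (auto intro!: interp_comp)
  note obs = interp_arr_sort[OF obs_alg_sorted[of arF P]]
  note conf = interp_arr_sort[OF conf_alg_sorted[of arF arP]]
  note mono = interp_arr_mono[OF obs_alg_mono, where S = "obs_sig arF P"]
  show ?thesis
  proof (rule lax_pullbackI)
    fix d :: "('a, 'b) val list" assume "map val_sort d = src (v2 ;; v1)"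
    then have d: "map val_sort d = src v2" by simp
    have "vals_le (interp_arr conf_alg r1 (interp_arr obs_alg v2 d))
        (interp_arr obs_alg u2 (interp_arr conf_alg r2 d))"
      using 2 d by (simp add: lax_pullback_def)
    then have "vals_le (interp_arr obs_alg u1 (interp_arr conf_alg r1 (interp_arr obs_alg v2 d)))
        (interp_arr obs_alg u1 (interp_arr obs_alg u2 (interp_arr conf_alg r2 d)))"
      using ty d by (intro mono) (simp_all add: obs conf)
    moreover have "vals_le (interp_arr conf_alg s1 (interp_arr obs_alg v1 (interp_arr obs_alg v2 d)))
        (interp_arr obs_alg u1 (interp_arr conf_alg r1 (interp_arr obs_alg v2 d)))"
      using 1 d ty by (simp add: lax_pullback_def obs)
    ultimately show "vals_le (interp_arr conf_alg s1 (interp_arr obs_alg (v2 ;; v1) d))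
        (interp_arr obs_alg (u2 ;; u1) (interp_arr conf_alg r2 d))"
      unfolding comps by (metis vals_le_trans)
  next
    fix a b :: "('a, 'b) val list"
    assume a: "map val_sort a = src s1" and b: "map val_sort b = src (u2 ;; u1)"
      and le: "vals_le (interp_arr conf_alg s1 a) (interp_arr obs_alg (u2 ;; u1) b)"
    have "map val_sort (interp_arr obs_alg u2 b) = src u1" using ty b obs[of u2 b] by simp
    from lax_pullbackE[OF 1 a this le[unfolded comps]]
    obtain d1 where d1: "map val_sort d1 = src v1" "vals_le a (interp_arr obs_alg v1 d1)"
      "vals_le (interp_arr conf_alg r1 d1) (interp_arr obs_alg u2 b)" .
    have "map val_sort d1 = src r1" using ty d1(1) by simp
    from lax_pullbackE[OF 2 this _ d1(3)] b
    obtain d where d: "map val_sort d = src v2" "vals_le d1 (interp_arr obs_alg v2 d)"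
      "vals_le (interp_arr conf_alg r2 d) b" by auto
    have "vals_le (interp_arr obs_alg v1 d1) (interp_arr obs_alg v1 (interp_arr obs_alg v2 d))"
      using ty d d1 by (intro mono) simp_all
    then have "vals_le a (interp_arr obs_alg (v2 ;; v1) d)"
      using d1(2) unfolding comps by (metis vals_le_trans)
    then show "\<exists>d. map val_sort d = src (v2 ;; v1) \<and> vals_le a (interp_arr obs_alg (v2 ;; v1) d) \<and>
        vals_le (interp_arr conf_alg r2 d) b"
      using d by auto
  qed
qed

lemma sorted_vals_appendE:
  assumes "map val_sort d = \<Gamma> @ \<Delta>"
  obtains d1 d2 where "d = d1 @ d2" "map val_sort d1 = \<Gamma>" "map val_sort d2 = \<Delta>"
  using assms by (metis map_eq_append_conv)

text \<open>Everything splits componentwise, the boundary types telling where to cut the lists of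
  values.\<close>

lemma lax_pullback_pcomp:
  assumes "tile_typed arF arP P s1 u1 v1 r1" "tile_typed arF arP P s2 u2 v2 r2"
    and 1: "lax_pullback s1 u1 v1 r1" and 2: "lax_pullback s2 u2 v2 r2"
  shows "lax_pullback (s1 \<otimes> s2) (u1 \<otimes> u2) (v1 \<otimes> v2) (r1 \<otimes> r2)"
proof -
  note ty = assms(1,2)[unfolded tile_typed_def]
  have pars:
    "map val_sort a = src s1 \<Longrightarrow> interp_arr conf_alg (s1 \<otimes> s2) (a @ b) = interp_arr conf_alg s1 a @ interp_arr conf_alg s2 b"
    "map val_sort a = src u1 \<Longrightarrow> interp_arr obs_alg (u1 \<otimes> u2) (a @ b) = interp_arr obs_alg u1 a @ interp_arr obs_alg u2 b"
    "map val_sort a = src v1 \<Longrightarrow> interp_arr obs_alg (v1 \<otimes> v2) (a @ b) = interp_arr obs_alg v1 a @ interp_arr obs_alg v2 b"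
    "map val_sort a = src r1 \<Longrightarrow> interp_arr conf_alg (r1 \<otimes> r2) (a @ b) = interp_arr conf_alg r1 a @ interp_arr conf_alg r2 b"
    for a b
    using ty by (auto intro!: interp_par dest: arg_cong[of _ _ length])
  note obs = interp_arr_sort[OF obs_alg_sorted[of arF P]]
  note conf = interp_arr_sort[OF conf_alg_sorted[of arF arP]]
  \<comment> \<open>Both front parts have the length of \<open>tgt s1\<close>, so an inequality
    between concatenations separates into one for each tile.\<close>
  have len: "length (interp_arr conf_alg s1 a) = length (tgt s1)"
    "length (interp_arr obs_alg u1 b) = length (tgt s1)" for a b
    using ty by (auto simp: interp_arr_def is_arr_def)
  show ?thesis
  proof (rule lax_pullbackI)
    fix d :: "('a, 'b) val list" assume "map val_sort d = src (v1 \<otimes> v2)"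
    then obtain d1 d2 where d: "d = d1 @ d2" "map val_sort d1 = src v1" "map val_sort d2 = src v2"
      by (auto elim: sorted_vals_appendE)
    then show "vals_le (interp_arr conf_alg (s1 \<otimes> s2) (interp_arr obs_alg (v1 \<otimes> v2) d))
        (interp_arr obs_alg (u1 \<otimes> u2) (interp_arr conf_alg (r1 \<otimes> r2) d))"
      using 1 2 ty by (simp add: pars obs conf lax_pullback_def list_all2_appendI)
  next
    fix a b :: "('a, 'b) val list"
    assume "map val_sort a = src (s1 \<otimes> s2)" and "map val_sort b = src (u1 \<otimes> u2)"
      and le: "vals_le (interp_arr conf_alg (s1 \<otimes> s2) a) (interp_arr obs_alg (u1 \<otimes> u2) b)"
    then obtain a1 a2 b1 b2 where a: "a = a1 @ a2" "map val_sort a1 = src s1" "map val_sort a2 = src s2"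
      and b: "b = b1 @ b2" "map val_sort b1 = src u1" "map val_sort b2 = src u2"
      by (auto elim!: sorted_vals_appendE)
    have "vals_le (interp_arr conf_alg s1 a1) (interp_arr obs_alg u1 b1)"
      "vals_le (interp_arr conf_alg s2 a2) (interp_arr obs_alg u2 b2)"
      using le a b by (simp_all add: pars list_all2_append len)
    then obtain d1 d2 where
      "map val_sort d1 = src v1" "vals_le a1 (interp_arr obs_alg v1 d1)" "vals_le (interp_arr conf_alg r1 d1) b1"
      "map val_sort d2 = src v2" "vals_le a2 (interp_arr obs_alg v2 d2)" "vals_le (interp_arr conf_alg r2 d2) b2"
      using 1 2 a b unfolding lax_pullback_def by blast
    then show "\<exists>d. map val_sort d = src (v1 \<otimes> v2) \<and> vals_le a (interp_arr obs_alg (v1 \<otimes> v2) d) \<and>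
        vals_le (interp_arr conf_alg (r1 \<otimes> r2) d) b"
      using a b ty by (intro exI[of _ "d1 @ d2"]) (simp add: pars list_all2_appendI)
  qed
qed

text \<open>The clause tile and the three compositions are treated above. In the other pullback
  tiles all values are terms, ordered by equality, so the hypothesis is an equation that determines
  the factor. For an identity tile the factor is one of the two given lists.\<close>

lemma entailed_lax_pullback:
  assumes "logic_program arF arP P" "entailed arF arP P s u v r"
  shows "lax_pullback s u v r"
  using assms(2)
proof (induction rule: entailed.induct)
  case (clause c p us)
  from entailed_typed[OF assms(1) entailed.clause[OF clause]]
  have "is_arr (obs_sig arF P) (subst_obs (nvars c) us :: ('a, 'b) oop arr)"
    "is_arr (conf_sig arF arP) (goal_conf (nvars c) (map Some (body c)))" "length us = arP p"
    by (auto simp: tile_typed_def dest: arg_cong[of _ _ length])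
  then show ?case using clause(2) by (intro lax_pullback_clause)
next
  case (pb_fun f)
  show ?case
  proof (rule lax_pullbackI, goal_cases)
    case (1 d)
    then show ?case by (simp add: vals_ST interp_ident interp_op_arr)
  next
    case (2 a b)
    \<comment> \<open>Term constructors are injective.\<close>
    then have "map val_term a = map val_term b"
      by (simp add: vals_ST interp_op_arr)
    then have "a = b" using 2 by (intro map_val_term_inj) auto
    then show ?case using 2 by (auto simp: vals_ST interp_ident)
  qed
next
  case (pb_fun_dup f)
  let ?s = "op_arr (\<t>^(arF f)) ST (CFun f :: ('a, 'b) cop) \<otimes> ident (\<t>^1)"
  have s: "interp_arr conf_alg ?s (e @ [x]) = [conf_alg (CFun f) e, x]" if "length e = arF f" for e x
  proof -
    have "is_arr (\<lambda>_. Some (\<t>^(arF f), ST)) (op_arr (\<t>^(arF f)) ST (CFun f :: ('a, 'b) cop))"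
      by (simp add: is_arr_op_arr)
    from interp_par[OF this, of e] that show ?thesis
      by (simp add: interp_op_arr interp_ident del: replicate.simps One_nat_def)
  qed
  show ?case
  proof (rule lax_pullbackI, goal_cases)
    case (1 d)
    then have "length d = arF f" by (simp add: vals_ST)
    then show ?case by (simp only: interp_dup_op s) (simp add: interp_op_arr interp_dup)
  next
    case (2 a b)
    then obtain e x y where "a = e @ [x]" "b = [y]" "length e = arF f" "map val_sort e = \<t>^(arF f)"
        "val_sort x = ST" "val_sort y = ST"
      by (auto elim!: sorted_vals_appendE simp: vals_ST map_eq_Cons_conv)
    \<comment> \<open>The duplicator on the trigger side equates both components with
      \<open>y\<close>. Thus \<open>a\<close> lies on the graph of \<open>f\<close>, and its
      argument list \<open>e\<close> is the factor; the mirrored tile below is treated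
      alike.\<close>
    moreover from this have "y = conf_alg (CFun f) e" "x = y"
      using 2(3) by (simp_all only: s) (auto simp: interp_dup val_le_sort_TermV)
    ultimately show ?case
      by (intro exI[of _ e]) (simp add: interp_dup_op interp_op_arr)
  qed
next
  case (pb_dup_fun f)
  let ?u = "op_arr (\<t>^(arF f)) ST (OFun f :: ('a, 'b) oop) \<otimes> ident (\<t>^1)"
  have u: "interp_arr obs_alg ?u (e @ [x]) = [obs_alg (OFun f) e, x]" if "length e = arF f" for e x
  proof -
    have "is_arr (\<lambda>_. Some (\<t>^(arF f), ST)) (op_arr (\<t>^(arF f)) ST (OFun f :: ('a, 'b) oop))"
      by (simp add: is_arr_op_arr)
    from interp_par[OF this, of e] that show ?thesis
      by (simp add: interp_op_arr interp_ident del: replicate.simps One_nat_def)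
  qed
  show ?case
  proof (rule lax_pullbackI, goal_cases)
    case (1 d)
    then have "length d = arF f" by (simp add: vals_ST)
    then show ?case by (simp only: interp_dup_op u) (simp add: interp_op_arr interp_dup)
  next
    case (2 a b)
    then obtain e x y where "b = e @ [x]" "a = [y]" "length e = arF f" "map val_sort e = \<t>^(arF f)"
        "val_sort x = ST" "val_sort y = ST"
      by (auto elim!: sorted_vals_appendE simp: vals_ST map_eq_Cons_conv)
    moreover from this have "y = obs_alg (OFun f) e" "x = y"
      using 2(3) by (simp_all only: u) (auto simp: interp_dup val_le_TermV_sort)
    ultimately show ?case
      by (intro exI[of _ e]) (simp add: interp_dup_op interp_op_arr)
  qed
next
  case pb_dup
  show ?case
    by (rule lax_pullbackI)
       (auto simp: interp_dup interp_ident map_eq_Cons_conv val_le_TermV_sort)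
next
  case pb_swap
  have swap: "interp_arr I (swap [ST] [ST]) [x, y] = [y, x]" for I and x y :: "('a, 'b) val"
    using interp_swap[of "[x]" "[ST]" "[y]" "[ST]" I] by simp
  show ?case
  proof (rule lax_pullbackI, goal_cases)
    case (1 d)
    then show ?case by (auto simp: swap interp_ident map_eq_Cons_conv numeral_2_eq_2)
  next
    case (2 a b)
    then have "a = b" by (auto simp: swap map_eq_Cons_conv val_le_TermV_sort numeral_2_eq_2)
    with 2 show ?case by (intro exI[of _ a]) (auto simp: vals_ST interp_ident numeral_2_eq_2)
  qed
next
  case pb_dup_dup
  have s: "interp_arr I (dup [ST] \<otimes> ident [ST]) [x, y] = [x, x, y]" for I and x y :: "('a, 'b) val"
    using interp_par[OF is_arr_dup, of "[x]" "[ST]" I "ident [ST]" "[y]"]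
    by (simp add: interp_dup interp_ident)
  have u: "interp_arr I (ident [ST] \<otimes> dup [ST]) [x, y] = [x, y, y]" for I and x y :: "('a, 'b) val"
    using interp_par[OF is_arr_ident, of "[x]" "[ST]" I "dup [ST]" "[y]"]
    by (simp add: interp_dup interp_ident)
  show ?case
    by (rule lax_pullbackI)
       (auto simp: s u interp_dup map_eq_Cons_conv val_le_TermV_sort)
next
  case (id_conf h)
  then have "length (interp_arr conf_alg h d) = length (tgt h)" for d :: "('a, 'b) val list"
    by (simp add: interp_arr_def is_arr_def)
  then show ?case by (intro lax_pullbackI) (auto simp: interp_ident interp_ident_sorted)
next
  case (id_obs h)
  then have "length (interp_arr obs_alg h d) = length (tgt h)" for d :: "('a, 'b) val list"
    by (simp add: interp_arr_def is_arr_def)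
  then show ?case by (intro lax_pullbackI) (auto simp: interp_ident interp_ident_sorted)
next
  case (hcomp s1 u1 v1 r1 s2 v2 r2)
  then show ?case
    using lax_pullback_hcomp[OF entailed_typed[OF assms(1)] entailed_typed[OF assms(1)]] by blast
next
  case (vcomp s1 u1 v1 r1 u2 v2 r2)
  then show ?case
    using lax_pullback_vcomp[OF entailed_typed[OF assms(1)] entailed_typed[OF assms(1)]] by blast
next
  case (pcomp s1 u1 v1 r1 s2 u2 v2 r2)
  then show ?case
    using lax_pullback_pcomp[OF entailed_typed[OF assms(1)] entailed_typed[OF assms(1)]] by blast
qed

section \<open>The answers described by a refutation tile\<close>

text \<open>A variable of the trigger stands for an empty subgoal: the final configuration of a
  refutation tile instantiates it with \<open>\<box>\<close>.\<close>

fun trigger_tree :: "('f, 'p) oop tm \<Rightarrow> ('f, 'p) dtree" where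
  "trigger_tree (Var i) = Empty"
| "trigger_tree (Op (OClause c) ws) = Resolve c (map trigger_tree ws)"
| "trigger_tree (Op (OFun f) ws) = Empty"

text \<open>Only clause operators have result sort \<open>SP\<close>, and their arguments have this
  sort again, so the evaluation meets nothing but clauses and the boxes put for the
  variables.\<close>

lemma interp_trigger:
  "has_sort (obs_sig arF P) \<Gamma> t \<tau> \<Longrightarrow> \<Gamma> = \<p>^m \<Longrightarrow> \<tau> = SP \<Longrightarrow>
    interp obs_alg (replicate m (ProofV Empty)) t = ProofV (trigger_tree t)"
proof (induction rule: has_sort.induct)
  case (1 i)
  then show ?case by simp
next
  case (2 g \<sigma>s \<tau> us)
  then obtain c where g: "g = OClause c" "\<sigma>s = \<p>^(length (body c))"
    by (cases g) (auto split: if_splits)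
  have "interp obs_alg (replicate m (ProofV Empty)) u = ProofV (trigger_tree u)"
    if "u \<in> set us" for u
    using 2 g that by (auto simp: in_set_conv_nth)
  then show ?case using g by simp
qed

definition proves :: "('f, 'p) atom \<Rightarrow> ('f, 'p) oop tm \<Rightarrow> bool" where
  "proves A t \<longleftrightarrow> derives (Goal A) (trigger_tree t)"

text \<open>One resolution step at the root, the form in which derivations are compared with SLD
  steps. A root without clause is excluded because a goal never derives
  \<open>Empty\<close>.\<close>

lemma proves_iff:
  "proves A t \<longleftrightarrow> (\<exists>c ws \<sigma>. t = Op (OClause c) ws \<and> A = subst_atom \<sigma> (head c) \<and>
     list_all2 (\<lambda>B w. proves (subst_atom \<sigma> B) w) (body c) ws)"
proof
  assume pr: "proves A t"
  then obtain c ws where t: "t = Op (OClause c) ws"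
    unfolding proves_def by (cases t rule: trigger_tree.cases) (auto elim: derives_Goal_EmptyE)
  then have "derives (Goal A) (Resolve c (map trigger_tree ws))"
    using pr by (simp add: proves_def)
  then show "\<exists>c ws \<sigma>. t = Op (OClause c) ws \<and> A = subst_atom \<sigma> (head c) \<and>
      list_all2 (\<lambda>B w. proves (subst_atom \<sigma> B) w) (body c) ws"
    using t by (auto elim!: derives_Goal_ResolveE simp: list_all2_map1 list_all2_map2 proves_def)
next
  assume "\<exists>c ws \<sigma>. t = Op (OClause c) ws \<and> A = subst_atom \<sigma> (head c) \<and>
      list_all2 (\<lambda>B w. proves (subst_atom \<sigma> B) w) (body c) ws"
  then show "proves A t"
    by (auto simp: proves_def list_all2_map1 list_all2_map2 intro!: derives_Goal)
qed

lemma derives_Empty_iff: "derives Empty y \<longleftrightarrow> y = Empty"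
  by (auto intro: derives_refl elim: derives_EmptyE)

text \<open>The solutions \<tau> in this sense are the common yardstick for the tile answer and the
  computed answer. An empty subgoal has to meet a term without a clause at its root.\<close>

definition goals_proved ::
  "(nat \<Rightarrow> 'f tm) \<Rightarrow> ('f, 'p) atom option list \<Rightarrow> ('f, 'p) oop tm list \<Rightarrow> bool" where
  "goals_proved \<tau> gs ts \<longleftrightarrow>
     list_all2 (\<lambda>g t. case g of None \<Rightarrow> trigger_tree t = Empty | Some A \<Rightarrow> proves (subst_atom \<tau> A) t)
       gs ts"

definition atom_vars :: "('f, 'p) atom \<Rightarrow> nat set" where
  "atom_vars A = (\<Union>u \<in> set (snd A). vars u)"

lemma subst_atom_cong:
  "(\<And>i. i \<in> atom_vars A \<Longrightarrow> \<sigma> i = \<tau> i) \<Longrightarrow> subst_atom \<sigma> A = subst_atom \<tau> A"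
  by (auto simp: subst_atom_def atom_vars_def intro!: subst_cong)

lemma subst_atom_subst_atom:
  "subst_atom \<tau> (subst_atom \<sigma> A) = subst_atom (\<lambda>i. subst \<tau> (\<sigma> i)) A"
  by (simp add: subst_atom_def subst_subst)

lemma atom_vars_subst_atom: "atom_vars (subst_atom \<sigma> A) = (\<Union>i \<in> atom_vars A. vars (\<sigma> i))"
  by (auto simp: atom_vars_def subst_atom_def vars_subst)

lemma goals_proved_cong:
  assumes "\<And>A. Some A \<in> set gs \<Longrightarrow> subst_atom \<sigma> A = subst_atom \<tau> A"
  shows "goals_proved \<sigma> gs ts \<longleftrightarrow> goals_proved \<tau> gs ts"
  unfolding goals_proved_def
  by (rule list.rel_cong[OF refl refl]) (use assms in \<open>auto split: option.splits\<close>)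

lemma refutation_tile_typed:
  assumes "logic_program arF arP P"
    and "refutation_tile arF arP P (goal_conf l gs) s (subst_obs n \<theta>) m n"
  shows "is_arr (conf_sig arF arP) (goal_conf l gs)" "is_arr (obs_sig arF P) s"
    "is_arr (obs_sig arF P) (subst_obs n \<theta> :: ('f, 'p) oop arr)"
    "length \<theta> = l" "src s = \<p>^m" "tgt s = \<p>^(length gs)"
  using entailed_typed[OF assms(1) assms(2)[unfolded refutation_tile_def]]
  by (auto simp: tile_typed_def dest: arg_cong[of _ _ length])

text \<open>The lax pullback property is applied to the values of \<tau> and to \<open>m\<close>
  boxes. The final configuration discards its argument and always yields these boxes, so the
  condition on it is trivially met. What remains says that \<tau> solves the goal iff its values are
  those of \<theta> at some \<open>d\<close>.\<close>

lemma refutation_tile_answers: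
  fixes gs :: "('f, 'p) atom option list"
  assumes lp: "logic_program arF arP P"
    and rt: "refutation_tile arF arP P (goal_conf l gs) s (subst_obs n \<theta>) m n"
  shows "goals_proved \<tau> gs (tms s) \<longleftrightarrow> (\<exists>\<delta>. \<forall>i < l. \<tau> i = subst \<delta> (\<theta> ! i))"
proof -
  note ty = refutation_tile_typed[OF lp rt]
  have pb: "lax_pullback (goal_conf l gs) s (subst_obs n \<theta>) (box_pow m \<otimes> disch (\<t>^n))"
    using entailed_lax_pullback[OF lp] rt by (simp add: refutation_tile_def)
  let ?b = "replicate m (ProofV Empty) :: ('f, 'p) val list"
  have final: "interp_arr conf_alg (box_pow m \<otimes> disch (\<t>^n)) d = ?b" for d
    by (simp add: interp_arr_def par_def box_pow_def disch_def)
  have "interp obs_alg ?b t = ProofV (trigger_tree t)" if "t \<in> set (tms s)" for t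
    using ty(2,5,6) that by (auto simp: is_arr_def in_set_conv_nth intro!: interp_trigger)
  then have trigger: "interp_arr obs_alg s ?b = map (\<lambda>t. ProofV (trigger_tree t)) (tms s)"
    by (simp add: interp_arr_def)
  define a where "a = (map TermV (map \<tau> [0..<l]) :: ('f, 'p) val list)"
  have a: "map val_sort a = \<t>^l" by (simp only: a_def map_TermV_sort) simp
  have "subst_atom (\<lambda>i. val_term (a ! i)) A = subst_atom \<tau> A" if "Some A \<in> set gs" for A
    using goal_conf_vars[OF ty(1) that]
    by (intro subst_atom_cong) (auto simp: atom_vars_def a_def)
  then have "goals_proved \<tau> gs (tms s) \<longleftrightarrow> goals_proved (\<lambda>i. val_term (a ! i)) gs (tms s)"
    by (intro goals_proved_cong) simp
  also have "\<dots> \<longleftrightarrow> vals_le (interp_arr conf_alg (goal_conf l gs) a) (interp_arr obs_alg s ?b)"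
    unfolding interp_goal_conf[OF ty(1) a] trigger list_all2_map1 list_all2_map2 goals_proved_def
    by (rule list.rel_cong[OF refl refl])
       (auto split: option.splits simp: proves_def derives_Empty_iff)
  also have "\<dots> \<longleftrightarrow> (\<exists>\<delta>. \<forall>i < l. \<tau> i = subst \<delta> (\<theta> ! i))"
  proof
    assume "vals_le (interp_arr conf_alg (goal_conf l gs) a) (interp_arr obs_alg s ?b)"
    from lax_pullbackE[OF pb _ _ this] a ty(5)
    obtain d where d: "map val_sort d = \<t>^n"
      and le: "vals_le a (interp_arr obs_alg (subst_obs n \<theta>) d)"
      by auto
    \<comment> \<open>Between lists of terms the order is equality, so \<tau> is an exact instance
      of \<theta>.\<close>
    have "map \<tau> [0..<l] = map (subst (\<lambda>i. val_term (d ! i))) \<theta>"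
      using le unfolding a_def interp_subst_obs[OF ty(3) d] map_map[symmetric, unfolded o_def]
      by (simp only: vals_le_map_TermV)
    then have "\<tau> i = subst (\<lambda>i. val_term (d ! i)) (\<theta> ! i)" if "i < l" for i
      using that ty(4) by (auto dest: arg_cong[of _ _ "\<lambda>xs. xs ! i"])
    then show "\<exists>\<delta>. \<forall>i < l. \<tau> i = subst \<delta> (\<theta> ! i)" by blast
  next
    assume "\<exists>\<delta>. \<forall>i < l. \<tau> i = subst \<delta> (\<theta> ! i)"
    then obtain \<delta> where \<delta>: "\<forall>i < l. \<tau> i = subst \<delta> (\<theta> ! i)" by blast
    define d where "d = (map TermV (map \<delta> [0..<n]) :: ('f, 'p) val list)"
    have d: "map val_sort d = \<t>^n" by (simp only: d_def map_TermV_sort) simp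
    have "subst (\<lambda>i. val_term (d ! i)) u = subst \<delta> u" if "u \<in> set \<theta>" for u
      using is_arr_vars[OF ty(3), of "map_tm OFun u"] that
      by (intro subst_cong) (auto simp: subst_obs_def d_def)
    then have "interp_arr obs_alg (subst_obs n \<theta>) d = map TermV (map (subst \<delta>) \<theta>)"
      by (simp add: interp_subst_obs[OF ty(3) d])
    also have "map (subst \<delta>) \<theta> = map \<tau> [0..<l]"
      using \<delta> ty(4) by (auto intro!: nth_equalityI)
    finally have "interp_arr obs_alg (subst_obs n \<theta>) d = a" by (simp add: a_def)
    then show "vals_le (interp_arr conf_alg (goal_conf l gs) a) (interp_arr obs_alg s ?b)"
      using pb d final[of d] unfolding lax_pullback_def by (metis arr_ends(15))
  qed
  finally show ?thesis .
qed

section \<open>Nodes of the forest\<close>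

text \<open>Refines \<open>clause_at\<close> by returning the whole subterm, so that the children
  remain accessible. A variable has an address here although it is not a node.\<close>

fun subtree_at :: "('f, 'p) oop tm list \<Rightarrow> node \<Rightarrow> ('f, 'p) oop tm option" where
  "subtree_at us [] = None"
| "subtree_at us (i # x) =
     (if i < length us then
        (if x = [] then Some (us ! i)
         else (case us ! i of Op (OClause c) ws \<Rightarrow> subtree_at ws x | _ \<Rightarrow> None))
      else None)"

lemma clause_at_eq_Some_iff:
  "clause_at us x = Some c \<longleftrightarrow> (\<exists>ws. subtree_at us x = Some (Op (OClause c) ws))"
  by (induction us x rule: subtree_at.induct) (auto split: tm.splits oop.splits)

text \<open>Lookup consumes a path from the root, whereas resolution extends it at its end.\<close>

lemma subtree_at_snoc:
  "x \<noteq> [] \<Longrightarrow> subtree_at us (x @ [j]) =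
     (case subtree_at us x of
        Some (Op (OClause c) ws) \<Rightarrow> if j < length ws then Some (ws ! j) else None
      | _ \<Rightarrow> None)"
proof (induction us x rule: subtree_at.induct)
  case (2 us i x)
  then show ?case by (cases "x = []") (auto split: tm.splits oop.splits)
qed simp

lemma subtree_at_has_sort:
  "subtree_at us x = Some t \<Longrightarrow> (\<And>u. u \<in> set us \<Longrightarrow> \<exists>\<tau>. has_sort S \<Gamma> u \<tau>) \<Longrightarrow>
    \<exists>\<tau>. has_sort S \<Gamma> t \<tau>"
proof (induction us x rule: subtree_at.induct)
  case (2 us i x)
  show ?case
  proof (cases "x = []")
    case True
    then show ?thesis using 2 by (auto split: if_splits)
  next
    case False
    then obtain c ws where i: "i < length us" "us ! i = Op (OClause c) ws" "subtree_at ws x = Some t"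
      using 2 by (auto split: if_splits tm.splits oop.splits)
    then obtain \<tau> where "has_sort S \<Gamma> (Op (OClause c) ws) \<tau>"
      using 2(3) by (metis nth_mem)
    then have "\<exists>\<tau>. has_sort S \<Gamma> u \<tau>" if "u \<in> set ws" for u
      using that by (cases rule: has_sort.cases) (auto simp: in_set_conv_nth)
    then show ?thesis using 2(1) i False by blast
  qed
qed simp

section \<open>SLD-derivations following the forest\<close>

text \<open>All that the resolution side needs from a refutation tile. Solvability ensures that
  unification succeeds at each node and that each body atom has a matching child node.\<close>

locale solvable_forest =
  fixes gs :: "('f, 'p) atom option list" and s :: "('f, 'p) oop arr" and l :: nat
  assumes clause_vars:
      "\<And>x c ws A. subtree_at (tms s) x = Some (Op (OClause c) ws) \<Longrightarrow>
        A \<in> set (head c # body c) \<Longrightarrow> atom_vars A \<subseteq> {..<nvars c}"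
    and goal_vars: "\<And>A. Some A \<in> set gs \<Longrightarrow> atom_vars A \<subseteq> {..<l}"
    and solvable: "\<exists>\<tau>. goals_proved \<tau> gs (tms s)"
begin

text \<open>The addresses of the subgoals that are open once the clauses at \<open>K\<close> have
  been applied.\<close>

definition frontier :: "node set \<Rightarrow> node set" where
  "frontier K = {x \<in> forest_nodes s. x \<notin> K \<and> (length x = 1 \<or> butlast x \<in> K)}"

text \<open>Here \<delta> is the part of the answer still to be found; the tag of an atom selects
  the subtree that has to refute it.\<close>

definition open_proved :: "(nat \<Rightarrow> 'f tm) \<Rightarrow> (node \<times> ('f, 'p) atom) list \<Rightarrow> bool" where
  "open_proved \<delta> hs \<longleftrightarrow>
     (\<forall>x A. (x, A) \<in> set hs \<longrightarrow>
       (\<exists>t. subtree_at (tms s) x = Some t \<and> proves (subst_atom \<delta> A) t))"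

text \<open>\<open>K\<close> is the set of nodes whose clauses have been applied.\<close>

definition sld_invariant :: "node set \<Rightarrow> ('f, 'p) sld_state \<Rightarrow> bool" where
  "sld_invariant K S \<longleftrightarrow> (case S of (V, \<alpha>, hs) \<Rightarrow>
     finite V \<and> (\<forall>i < l. vars (\<alpha> i) \<subseteq> V) \<and> (\<forall>x A. (x, A) \<in> set hs \<longrightarrow> atom_vars A \<subseteq> V) \<and>
     (\<forall>x \<in> K. length x = 1 \<or> butlast x \<in> K) \<and>
     distinct (map fst hs) \<and> fst ` set hs = frontier K \<and>
     (\<forall>\<tau>. goals_proved \<tau> gs (tms s) \<longleftrightarrow>
       (\<exists>\<delta>. (\<forall>i < l. \<tau> i = subst \<delta> (\<alpha> i)) \<and> open_proved \<delta> hs)))"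

lemma sld_invariantD:
  assumes "sld_invariant K (V, \<alpha>, hs)"
  shows "finite V" "\<forall>i < l. vars (\<alpha> i) \<subseteq> V"
    "\<forall>x A. (x, A) \<in> set hs \<longrightarrow> atom_vars A \<subseteq> V"
    "\<forall>x \<in> K. length x = 1 \<or> butlast x \<in> K"
    "distinct (map fst hs)" "fst ` set hs = frontier K"
    "\<forall>\<tau>. goals_proved \<tau> gs (tms s) \<longleftrightarrow>
       (\<exists>\<delta>. (\<forall>i < l. \<tau> i = subst \<delta> (\<alpha> i)) \<and> open_proved \<delta> hs)"
  using assms unfolding sld_invariant_def prod.case by - (elim conjE, assumption)+

lemma forest_nodes_iff:
  "x \<in> forest_nodes s \<longleftrightarrow> (\<exists>c ws. subtree_at (tms s) x = Some (Op (OClause c) ws))"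
  unfolding forest_nodes_def dom_def using clause_at_eq_Some_iff[of "tms s" x] by auto

lemma node_subtree:
  assumes "x \<in> forest_nodes s"
  obtains ws where "subtree_at (tms s) x = Some (Op (OClause (node_clause s x)) ws)"
proof -
  obtain c where "clause_at (tms s) x = Some c"
    using assms by (auto simp: forest_nodes_def)
  then show ?thesis
    using that clause_at_eq_Some_iff[of "tms s" x c] by (auto simp: node_clause_def)
qed

lemma forest_nodes_nonempty: "x \<in> forest_nodes s \<Longrightarrow> x \<noteq> []"
  by (auto simp: forest_nodes_iff)

lemma butlast_forest_nodes:
  assumes "x \<in> forest_nodes s" "length x \<noteq> 1"
  shows "butlast x \<in> forest_nodes s"
proof -
  obtain y j where x: "x = y @ [j]"
    using forest_nodes_nonempty[OF assms(1)] by (cases x rule: rev_cases) auto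
  then have "y \<noteq> []" using assms(2) by auto
  then show ?thesis
    using assms(1) subtree_at_snoc[of y "tms s" j] x
    by (auto simp: forest_nodes_iff split: option.splits tm.splits oop.splits)
qed

section \<open>Open subgoals under substitution, and preservation of the invariant\<close>

lemma open_proved_append [simp]:
  "open_proved \<delta> (hs @ hs') \<longleftrightarrow> open_proved \<delta> hs \<and> open_proved \<delta> hs'"
  unfolding open_proved_def set_append Un_iff by blast

lemma open_proved_Cons [simp]:
  "open_proved \<delta> ((x, A) # hs) \<longleftrightarrow>
     (\<exists>t. subtree_at (tms s) x = Some t \<and> proves (subst_atom \<delta> A) t) \<and> open_proved \<delta> hs"
  unfolding open_proved_def list.set insert_iff prod.inject by blast

lemma open_proved_Nil [simp]: "open_proved \<delta> []"
  by (simp add: open_proved_def)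

lemma open_proved_map:
  "open_proved \<delta> (map (\<lambda>j. (g j, h j)) js) \<longleftrightarrow>
     (\<forall>j \<in> set js. \<exists>t. subtree_at (tms s) (g j) = Some t \<and> proves (subst_atom \<delta> (h j)) t)"
  by (induction js) simp_all

lemma open_proved_cong:
  assumes "\<And>x A. (x, A) \<in> set hs \<Longrightarrow> atom_vars A \<subseteq> V" "\<And>i. i \<in> V \<Longrightarrow> \<delta> i = \<epsilon> i"
  shows "open_proved \<delta> hs \<longleftrightarrow> open_proved \<epsilon> hs"
  using assms(1)
proof (induction hs)
  case (Cons h hs)
  obtain x A where h: "h = (x, A)" by (cases h)
  then have "subst_atom \<delta> A = subst_atom \<epsilon> A"
    using Cons.prems[of x A] assms(2) by (intro subst_atom_cong) auto
  moreover have "open_proved \<delta> hs \<longleftrightarrow> open_proved \<epsilon> hs"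
    using Cons.prems by (intro Cons.IH) (meson list.set_intros(2))
  ultimately show ?case using h by simp
qed simp

lemma open_proved_map_subst:
  "open_proved \<delta> (map (apsnd (subst_atom \<sigma>)) hs) \<longleftrightarrow> open_proved (\<lambda>i. subst \<delta> (\<sigma> i)) hs"
proof (induction hs)
  case (Cons h hs)
  then show ?case by (cases h) (simp add: subst_atom_subst_atom)
qed simp

text \<open>Before any step the computed substitution is the identity, so the substitution still to
  be found is \<tau> itself on the \<open>l\<close> goal variables.\<close>

lemma sld_invariant_init: "sld_invariant {} (sld_init l gs)"
proof -
  define hs where
    "hs = map (\<lambda>i. ([i], the (gs ! i))) (filter (\<lambda>i. gs ! i \<noteq> None) [0..<length gs])"
  obtain \<tau>0 where \<tau>0: "goals_proved \<tau>0 gs (tms s)" using solvable by blast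
  then have len: "length (tms s) = length gs"
    by (auto simp: goals_proved_def list_all2_lengthD)
  have none: "trigger_tree (tms s ! i) = Empty" if "i < length gs" "gs ! i = None" for i
    using \<tau>0 that by (auto simp: goals_proved_def list_all2_conv_all_nth)
  \<comment> \<open>By solvability each atom of the goal faces a clause; together with
    \<open>none\<close> this makes the roots of the forest exactly the tags of the initial
    goal.\<close>
  have some: "\<exists>c ws. tms s ! i = Op (OClause c) ws" if "i < length gs" "gs ! i = Some A" for i A
  proof -
    have "proves (subst_atom \<tau>0 A) (tms s ! i)"
      using list_all2_nthD[OF \<tau>0[unfolded goals_proved_def] that(1)] that(2) by simp
    then show ?thesis by (subst (asm) proves_iff) blast
  qed
  have hs_iff: "(x, A) \<in> set hs \<longleftrightarrow> (\<exists>i < length gs. x = [i] \<and> gs ! i = Some A)" for x A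
    by (force simp: hs_def)
  have root: "subtree_at (tms s) [i] = Some (tms s ! i)" if "i < length gs" for i
    using that len by simp
  have "goals_proved \<tau> gs (tms s) \<longleftrightarrow> open_proved \<tau> hs" for \<tau>
  proof
    assume g: "goals_proved \<tau> gs (tms s)"
    show "open_proved \<tau> hs"
      unfolding open_proved_def hs_iff
    proof (intro allI impI)
      fix x A assume "\<exists>i < length gs. x = [i] \<and> gs ! i = Some A"
      then obtain i where i: "i < length gs" "x = [i]" "gs ! i = Some A" by blast
      then have "proves (subst_atom \<tau> A) (tms s ! i)"
        using list_all2_nthD[OF g[unfolded goals_proved_def] i(1)] by simp
      then show "\<exists>t. subtree_at (tms s) x = Some t \<and> proves (subst_atom \<tau> A) t"
        using i root by blast
    qed
  next
    assume op: "open_proved \<tau> hs"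
    show "goals_proved \<tau> gs (tms s)"
      unfolding goals_proved_def
    proof (rule list_all2_all_nthI)
      fix i assume i: "i < length gs"
      show "case gs ! i of None \<Rightarrow> trigger_tree (tms s ! i) = Empty
        | Some A \<Rightarrow> proves (subst_atom \<tau> A) (tms s ! i)"
      proof (cases "gs ! i")
        case (Some A)
        then have "([i], A) \<in> set hs" using i hs_iff by blast
        then obtain t where "subtree_at (tms s) [i] = Some t" "proves (subst_atom \<tau> A) t"
          using op unfolding open_proved_def by blast
        then show ?thesis using root[OF i] Some by simp
      qed (simp add: none[OF i])
    qed (simp add: len)
  qed
  \<comment> \<open>Only the first \<open>l\<close> variables occur in the goal, so the values
    elsewhere are free.\<close>
  moreover have "goals_proved \<tau> gs (tms s) \<longleftrightarrow> goals_proved \<delta> gs (tms s)"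
    if "\<forall>i < l. \<tau> i = \<delta> i" for \<tau> \<delta>
    using that goal_vars by (intro goals_proved_cong subst_atom_cong) auto
  ultimately have answers: "goals_proved \<tau> gs (tms s) \<longleftrightarrow>
      (\<exists>\<delta>. (\<forall>i < l. \<tau> i = subst \<delta> (Var i)) \<and> open_proved \<delta> hs)" for \<tau>
    by auto
  have dist: "distinct (map fst hs)"
    by (simp add: hs_def o_def distinct_map inj_on_def)
  have tags: "fst ` set hs = frontier {}"
  proof (rule set_eqI)
    fix x
    have "gs ! i \<noteq> None \<longleftrightarrow> (\<exists>c ws. tms s ! i = Op (OClause c) ws)" if "i < length gs" for i
      using some[OF that] none[OF that] by (cases "gs ! i") auto
    then have "{i. i < length gs \<and> gs ! i \<noteq> None}
        = {i. i < length gs \<and> (\<exists>c ws. tms s ! i = Op (OClause c) ws)}"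
      by (intro Collect_cong conj_cong refl)
    then have "fst ` set hs
        = (\<lambda>i. [i]) ` {i. i < length gs \<and> (\<exists>c ws. tms s ! i = Op (OClause c) ws)}"
      by (simp add: hs_def image_image del: not_None_eq)
    then have "x \<in> fst ` set hs \<longleftrightarrow>
        (\<exists>i < length gs. x = [i] \<and> (\<exists>c ws. tms s ! i = Op (OClause c) ws))"
      by auto
    also have "\<dots> \<longleftrightarrow> x \<in> frontier {}"
      using len by (auto simp: frontier_def forest_nodes_iff length_Suc_conv split: if_splits)
    finally show "x \<in> fst ` set hs \<longleftrightarrow> x \<in> frontier {}" .
  qed
  have hs_vars: "atom_vars A \<subseteq> {..<l}" if "(x, A) \<in> set hs" for x A
  proof -
    have "Some A \<in> set gs" using that unfolding hs_iff by (metis nth_mem)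
    then show ?thesis by (rule goal_vars)
  qed
  have init: "sld_init l gs = ({..<l}, Var, hs)" by (simp only: sld_init_def hs_def)
  show ?thesis
    unfolding init sld_invariant_def prod.case
    by (intro conjI allI impI) (use answers dist tags hs_vars in \<open>blast | simp\<close>)+
qed

lemma sld_invariant_obtain:
  assumes "sld_invariant K (V, \<alpha>, hs)"
  obtains \<delta> where "open_proved \<delta> hs"
  using assms solvable by (auto simp: sld_invariant_def)

text \<open>A step loses no solution: a completion of the old goal, extended to the fresh variables,
  unifies the atom with the clause head and so factors through the mgu. It adds none either: a
  completion of the new goal, preceded by the mgu, completes the old one.\<close>

lemma sld_invariant_step:
  assumes inv: "sld_invariant K S" and step: "sld_step x (node_clause s x) S S'"
  shows "sld_invariant (insert x K) S'"
  using step
proof cases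
  case (1 \<rho> W V \<sigma> A bs \<alpha> hs1 hs2)
  define c where "c = node_clause s x"
  note step = 1[folded c_def]
  let ?hs = "hs1 @ (x, A) # hs2"
  note inv' = sld_invariantD[OF inv[unfolded step(1)]]
  note fin = inv'(1) and \<alpha> = inv'(2)[rule_format] and hsV = inv'(3)[rule_format]
    and K = inv'(4)[rule_format] and dist = inv'(5) and tags = inv'(6) and answers = inv'(7)[THEN spec]
  have "x \<in> frontier K" unfolding tags[symmetric] by simp
  then have x: "x \<in> forest_nodes s" "x \<notin> K" "length x = 1 \<or> butlast x \<in> K"
    by (auto simp: frontier_def)
  then have "x \<noteq> []" using forest_nodes_nonempty by blast
  obtain ws where ws: "subtree_at (tms s) x = Some (Op (OClause c) ws)"
    using node_subtree[OF x(1)] unfolding c_def by blast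
  have child: "subtree_at (tms s) (x @ [j]) = (if j < length ws then Some (ws ! j) else None)" for j
    using subtree_at_snoc[OF \<open>x \<noteq> []\<close>, of "tms s" j] ws by simp
  have proved_x: "(\<exists>t. subtree_at (tms s) x = Some t \<and> proves B t) \<longleftrightarrow>
      (\<exists>\<epsilon>. B = subst_atom \<epsilon> (head c) \<and>
        list_all2 (\<lambda>B w. proves (subst_atom \<epsilon> B) w) (body c) ws)" for B
    using ws by (auto simp: proves_iff[of B])
  obtain \<delta>0 where "open_proved \<delta>0 ?hs"
    using sld_invariant_obtain inv step(1) by blast
  \<comment> \<open>One proved instance of the body shows that the children of \<open>x\<close>
    correspond to the body atoms and are all labeled by clauses.\<close>
  then obtain \<epsilon>0 where \<epsilon>0: "list_all2 (\<lambda>B w. proves (subst_atom \<epsilon>0 B) w) (body c) ws"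
    using proved_x by auto
  then have len: "length ws = length (body c)" by (auto dest: list_all2_lengthD)
  have child_node: "x @ [j] \<in> forest_nodes s \<longleftrightarrow> j < length (body c)" for j
  proof
    assume "x @ [j] \<in> forest_nodes s"
    then show "j < length (body c)"
      using child[of j] len by (auto simp: forest_nodes_iff split: if_splits)
  next
    assume j: "j < length (body c)"
    then have "proves (subst_atom \<epsilon>0 (body c ! j)) (ws ! j)"
      using \<epsilon>0 by (auto simp: list_all2_conv_all_nth)
    then have "\<exists>c' ws'. ws ! j = Op (OClause c') ws'" by (subst (asm) proves_iff) blast
    then show "x @ [j] \<in> forest_nodes s"
      using child[of j] j len by (auto simp: forest_nodes_iff)
  qed
  have proved_bs: "open_proved \<delta> bs \<longleftrightarrow>
      list_all2 (\<lambda>B w. proves (subst_atom (\<lambda>i. \<delta> (\<rho> i)) B) w) (body c) ws" for \<delta>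
    unfolding step(7) open_proved_map
    by (auto simp: child len list_all2_conv_all_nth subst_atom_subst_atom)
  have closed: "atom_vars B \<subseteq> {..<nvars c}" if "B \<in> set (head c # body c)" for B
    using clause_vars[OF ws that] .
  have mgu: "subst_atom \<sigma> A = subst_atom \<sigma> (subst_atom (Var \<circ> \<rho>) (head c))"
    and most_general: "\<And>\<tau>. subst_atom \<tau> A = subst_atom \<tau> (subst_atom (Var \<circ> \<rho>) (head c)) \<Longrightarrow>
      \<exists>\<delta>. \<forall>i. \<tau> i = subst \<delta> (\<sigma> i)"
    using step(6) by (auto simp: is_mgu_def)
  have AV: "atom_vars A \<subseteq> V" using hsV[of x A] by simp
  have extend: "\<exists>\<delta>'. (\<forall>i \<in> V. \<delta> i = subst \<delta>' (\<sigma> i)) \<and>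
      open_proved (\<lambda>i. subst \<delta>' (\<sigma> i)) (hs1 @ bs @ hs2)" if op: "open_proved \<delta> ?hs" for \<delta>
  proof -
    obtain \<epsilon> where \<epsilon>: "subst_atom \<delta> A = subst_atom \<epsilon> (head c)"
      "list_all2 (\<lambda>B w. proves (subst_atom \<epsilon> B) w) (body c) ws"
      using op proved_x[of "subst_atom \<delta> A"] by auto
    \<comment> \<open>\<delta> on the old variables and, through the inverse of the renaming, the
      clause instance \<epsilon> on the fresh ones; disjointness of \<open>W\<close> and
      \<open>V\<close> makes this consistent.\<close>
    define \<eta> where "\<eta> i = (if i \<in> W then \<epsilon> (inv_into {..<nvars c} \<rho> i) else \<delta> i)" for i
    have \<eta>V: "\<eta> i = \<delta> i" if "i \<in> V" for i
      using that step(5) by (auto simp: \<eta>_def)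
    have \<eta>\<rho>: "\<eta> (\<rho> i) = \<epsilon> i" if "i < nvars c" for i
      using that step(3,4) by (auto simp: \<eta>_def)
    have \<eta>_clause: "subst_atom (\<lambda>i. \<eta> (\<rho> i)) B = subst_atom \<epsilon> B" if "B \<in> set (head c # body c)" for B
      using closed[OF that] \<eta>\<rho> by (intro subst_atom_cong) auto
    have "subst_atom \<eta> A = subst_atom \<delta> A"
      using AV \<eta>V by (intro subst_atom_cong) auto
    then have "subst_atom \<eta> A = subst_atom \<eta> (subst_atom (Var \<circ> \<rho>) (head c))"
      using \<epsilon>(1) \<eta>_clause[of "head c"] by (simp add: subst_atom_subst_atom)
    then obtain \<delta>' where \<delta>': "\<And>i. \<eta> i = subst \<delta>' (\<sigma> i)" using most_general by blast
    have "open_proved \<eta> bs"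
      unfolding proved_bs using \<epsilon>(2) \<eta>_clause by (auto simp: list_all2_conv_all_nth)
    moreover have "open_proved \<eta> ?hs"
      using op open_proved_cong[of ?hs V \<eta> \<delta>] hsV \<eta>V by blast
    ultimately have "open_proved \<eta> (hs1 @ bs @ hs2)" by simp
    then have "open_proved (\<lambda>i. subst \<delta>' (\<sigma> i)) (hs1 @ bs @ hs2)" unfolding \<delta>' .
    moreover have "\<forall>i \<in> V. \<delta> i = subst \<delta>' (\<sigma> i)" using \<eta>V \<delta>' by simp
    ultimately show ?thesis by blast
  qed
  \<comment> \<open>The mgu equation exhibits the selected atom as an instance of the clause head,
    with the proved children as its body.\<close>
  have restrict: "open_proved (\<lambda>i. subst \<delta>' (\<sigma> i)) ?hs"
    if "open_proved (\<lambda>i. subst \<delta>' (\<sigma> i)) (hs1 @ bs @ hs2)" for \<delta>'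
  proof -
    let ?\<eta> = "\<lambda>i. subst \<delta>' (\<sigma> i)"
    have "subst_atom ?\<eta> A = subst_atom (\<lambda>i. ?\<eta> (\<rho> i)) (head c)"
      using arg_cong[OF mgu, of "subst_atom \<delta>'"] by (simp add: subst_atom_subst_atom)
    moreover have "list_all2 (\<lambda>B w. proves (subst_atom (\<lambda>i. ?\<eta> (\<rho> i)) B) w) (body c) ws"
      using that proved_bs[of ?\<eta>] by simp
    ultimately have "\<exists>t. subtree_at (tms s) x = Some t \<and> proves (subst_atom ?\<eta> A) t"
      using proved_x by blast
    then show ?thesis using that by simp
  qed
  define V' where "V' = V \<union> W \<union> (\<Union>i \<in> V \<union> W. vars (\<sigma> i))"
  define hs' where "hs' = map (apsnd (subst_atom \<sigma>)) (hs1 @ bs @ hs2)"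
  have answers': "goals_proved \<tau> gs (tms s) \<longleftrightarrow>
      (\<exists>\<delta>. (\<forall>i < l. \<tau> i = subst \<delta> (subst \<sigma> (\<alpha> i))) \<and> open_proved \<delta> hs')" for \<tau>
  proof
    assume "goals_proved \<tau> gs (tms s)"
    then obtain \<delta> where \<delta>: "\<And>i. i < l \<Longrightarrow> \<tau> i = subst \<delta> (\<alpha> i)" "open_proved \<delta> ?hs"
      using answers by blast
    from extend[OF \<delta>(2)] obtain \<delta>' where \<delta>': "\<forall>i \<in> V. \<delta> i = subst \<delta>' (\<sigma> i)"
      "open_proved (\<lambda>i. subst \<delta>' (\<sigma> i)) (hs1 @ bs @ hs2)" by blast
    \<comment> \<open>The factorization is known on \<open>V\<close> only, which suffices since the
      variables of \<open>\<alpha> i\<close> lie in \<open>V\<close>.\<close>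
    have "\<tau> i = subst \<delta>' (subst \<sigma> (\<alpha> i))" if "i < l" for i
      unfolding \<delta>(1)[OF that] subst_subst
      by (rule subst_cong) (use \<delta>'(1) \<alpha>[OF that] in blast)
    then show "\<exists>\<delta>. (\<forall>i < l. \<tau> i = subst \<delta> (subst \<sigma> (\<alpha> i))) \<and> open_proved \<delta> hs'"
      using \<delta>'(2) unfolding hs'_def open_proved_map_subst by blast
  next
    assume "\<exists>\<delta>. (\<forall>i < l. \<tau> i = subst \<delta> (subst \<sigma> (\<alpha> i))) \<and> open_proved \<delta> hs'"
    then obtain \<delta> where "\<forall>i < l. \<tau> i = subst \<delta> (subst \<sigma> (\<alpha> i))"
      "open_proved (\<lambda>i. subst \<delta> (\<sigma> i)) (hs1 @ bs @ hs2)"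
      unfolding hs'_def open_proved_map_subst by blast
    then show "goals_proved \<tau> gs (tms s)"
      unfolding answers subst_subst using restrict by blast
  qed
  have fst_bs: "map fst bs = map (\<lambda>j. x @ [j]) [0..<length (body c)]"
    by (simp add: step(7))
  have fst_hs': "map fst hs' = map fst hs1 @ map fst bs @ map fst hs2"
    by (simp add: hs'_def)
  \<comment> \<open>\<open>K\<close> is closed under parents and does not contain \<open>x\<close>,
    so a child of \<open>x\<close> is neither applied nor open yet.\<close>
  have new: "x @ [j] \<notin> K" "x @ [j] \<notin> frontier K" for j
    using K[of "x @ [j]"] x(2) \<open>x \<noteq> []\<close> by (auto simp: frontier_def)
  have frontier': "frontier (insert x K) = (frontier K - {x}) \<union> (\<lambda>j. x @ [j]) ` {..<length (body c)}"
  proof (intro set_eqI iffI)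
    fix y assume y: "y \<in> frontier (insert x K)"
    then have y': "y \<in> forest_nodes s" "y \<notin> K" "y \<noteq> x" "length y = 1 \<or> butlast y = x \<or> butlast y \<in> K"
      by (auto simp: frontier_def)
    show "y \<in> (frontier K - {x}) \<union> (\<lambda>j. x @ [j]) ` {..<length (body c)}"
    proof (cases "butlast y = x")
      case True
      then have "y = x @ [last y]" using forest_nodes_nonempty[OF y'(1)] by auto
      then show ?thesis using child_node[of "last y"] y'(1) by auto
    next
      case False
      then show ?thesis using y' by (auto simp: frontier_def)
    qed
  next
    fix y assume "y \<in> (frontier K - {x}) \<union> (\<lambda>j. x @ [j]) ` {..<length (body c)}"
    then show "y \<in> frontier (insert x K)"
      using child_node new by (auto simp: frontier_def)
  qed
  \<comment> \<open>Tags are distinct, so taking out the selected occurrence removes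
    \<open>x\<close> from the set of tags.\<close>
  have tags12: "set (map fst hs1) \<union> set (map fst hs2) = frontier K - {x}"
    using tags dist by auto
  have "distinct (map fst bs)" unfolding fst_bs by (simp add: distinct_map inj_on_def)
  moreover have "set (map fst bs) \<inter> (set (map fst hs1) \<union> set (map fst hs2)) = {}"
    using new(2) unfolding tags12 fst_bs by auto
  moreover have "distinct (map fst hs1)" "distinct (map fst hs2)"
    "set (map fst hs1) \<inter> set (map fst hs2) = {}"
    using dist unfolding map_append distinct_append by auto
  ultimately have dist': "distinct (map fst hs')"
    unfolding fst_hs' distinct_append set_append by blast
  have tags': "fst ` set hs' = frontier (insert x K)"
  proof -
    have "set (map fst hs') = frontier (insert x K)"
      using tags12 unfolding fst_hs' fst_bs frontier' by auto
    then show ?thesis by simp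
  qed
  have fin': "finite V'" using fin step(4) by (simp add: V'_def)
  have \<alpha>': "vars (subst \<sigma> (\<alpha> i)) \<subseteq> V'" if "i < l" for i
    using \<alpha>[OF that] by (auto simp: vars_subst V'_def)
  have hsV': "atom_vars B \<subseteq> V'" if yB: "(y, B) \<in> set hs'" for y B
  proof -
    obtain B' where B: "B = subst_atom \<sigma> B'" "(y, B') \<in> set (hs1 @ bs @ hs2)"
      using yB by (auto simp: hs'_def)
    have "atom_vars B' \<subseteq> V \<union> W"
    proof (cases "(y, B') \<in> set bs")
      case True
      then obtain j where "j < length (body c)" "B' = subst_atom (Var \<circ> \<rho>) (body c ! j)"
        by (auto simp: step(7))
      then show ?thesis
        using closed[of "body c ! j"] step(4) by (auto simp: atom_vars_subst_atom)
    next
      case False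
      then show ?thesis using B(2) hsV[of y B'] by auto
    qed
    then show ?thesis by (auto simp: B(1) atom_vars_subst_atom V'_def)
  qed
  have K': "\<forall>y \<in> insert x K. length y = 1 \<or> butlast y \<in> insert x K"
    using K x(3) by auto
  have S': "S' = (V', \<lambda>i. subst \<sigma> (\<alpha> i), hs')"
    using step(2) by (simp add: V'_def hs'_def)
  show ?thesis
    unfolding S' sld_invariant_def prod.case
    by (intro conjI allI impI fin' \<alpha>' K' dist' tags' answers') (assumption, rule hsV')
qed

text \<open>A completion of the current goal, together with the clause instance it uses at
  \<open>x\<close>, unifies the atom with a renamed head; hence an mgu exists.\<close>

lemma sld_step_exists:
  assumes inv: "sld_invariant K S" and x: "x \<in> frontier K"
  shows "\<exists>S'. sld_step x (node_clause s x) S S'"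
proof -
  obtain V \<alpha> hs where S: "S = (V, \<alpha>, hs)" by (cases S)
  define c where "c = node_clause s x"
  have fin: "finite V" and hsV: "\<And>y B. (y, B) \<in> set hs \<Longrightarrow> atom_vars B \<subseteq> V"
    and tags: "fst ` set hs = frontier K"
    using sld_invariantD(1,3,6)[OF inv[unfolded S]] by blast+
  obtain A where A: "(x, A) \<in> set hs" using x tags by force
  then obtain hs1 hs2 where hs: "hs = hs1 @ (x, A) # hs2" by (meson split_list)
  obtain ws where ws: "subtree_at (tms s) x = Some (Op (OClause c) ws)"
    using x node_subtree[of x] unfolding c_def frontier_def by blast
  obtain \<delta> where "open_proved \<delta> hs" using sld_invariant_obtain inv S by blast
  then have "proves (subst_atom \<delta> A) (Op (OClause c) ws)"
    using hs ws by simp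
  then obtain \<epsilon> where \<epsilon>: "subst_atom \<delta> A = subst_atom \<epsilon> (head c)"
    by (subst (asm) proves_iff) auto
  obtain N where N: "\<And>i. i \<in> V \<Longrightarrow> i < N"
    using fin finite_nat_set_iff_bounded by auto
  \<comment> \<open>Shifting by a strict bound \<open>N\<close> of the used variables renames the
    clause apart.\<close>
  define \<rho> where "\<rho> i = N + i" for i
  have inj: "inj_on \<rho> {..<nvars c}" by (simp add: \<rho>_def inj_on_def)
  have disj: "\<rho> ` {..<nvars c} \<inter> V = {}" using N by (fastforce simp: \<rho>_def)
  \<comment> \<open>Below \<open>N\<close> the completion \<delta>, from \<open>N\<close> on the
    clause instance \<epsilon> shifted accordingly: a unifier of the atom and the renamed
    head.\<close>
  define \<eta> where "\<eta> i = (if i < N then \<delta> i else \<epsilon> (i - N))" for i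
  have "subst_atom \<eta> A = subst_atom \<delta> A"
    using hsV[OF A] N by (intro subst_atom_cong) (auto simp: \<eta>_def)
  moreover have "subst_atom \<eta> (subst_atom (Var \<circ> \<rho>) (head c)) = subst_atom \<epsilon> (head c)"
    by (simp add: subst_atom_subst_atom \<eta>_def \<rho>_def)
  ultimately obtain \<sigma> where "is_mgu \<sigma> A (subst_atom (Var \<circ> \<rho>) (head c))"
    using unifiable_is_mgu \<epsilon> by metis
  from sld_step.intros[OF inj refl disj this refl, of x \<alpha> hs1 hs2]
  show ?thesis unfolding S hs c_def by blast
qed

section \<open>Complete runs along the forest\<close>

lemma sld_run_invariant:
  assumes "sld_run (node_clause s) xs S S'" "sld_invariant K S"
  shows "sld_invariant (K \<union> set xs) S'"
  using assms
proof (induction arbitrary: K rule: sld_run.induct)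
  case (2 x S S' xs S'')
  then have "sld_invariant (insert x K \<union> set xs) S''" using sld_invariant_step by blast
  then show ?case by simp
qed simp

text \<open>The last assumption lists every node after its parent, so each node is on the frontier
  when its turn comes.\<close>

lemma sld_run_exists:
  assumes "sld_invariant K S" "distinct xs" "set xs \<subseteq> forest_nodes s - K"
    and "\<And>ys x zs. xs = ys @ x # zs \<Longrightarrow> length x = 1 \<or> butlast x \<in> K \<union> set ys"
  shows "\<exists>S'. sld_run (node_clause s) xs S S'"
  using assms
proof (induction xs arbitrary: K S)
  case Nil
  then show ?case by (blast intro: sld_run.intros)
next
  case (Cons x xs)
  have "x \<in> frontier K"
    using Cons.prems(3) Cons.prems(4)[of "[]" x xs] by (auto simp: frontier_def)
  then obtain S1 where S1: "sld_step x (node_clause s x) S S1"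
    using sld_step_exists Cons.prems(1) by blast
  have "length y = 1 \<or> butlast y \<in> insert x K \<union> set ys" if "xs = ys @ y # zs" for ys y zs
    using Cons.prems(4)[of "x # ys" y zs] that by auto
  moreover have "set xs \<subseteq> forest_nodes s - insert x K"
    using Cons.prems(2,3) by auto
  ultimately obtain S' where "sld_run (node_clause s) xs S1 S'"
    using Cons.IH[OF sld_invariant_step[OF Cons.prems(1) S1]] Cons.prems(2) by auto
  then show ?case using S1 by (blast intro: sld_run.intros)
qed

text \<open>With all nodes applied the frontier is empty, so no open subgoal constrains the
  completing substitution.\<close>

lemma sld_invariant_complete:
  assumes "sld_invariant (forest_nodes s) (V, \<alpha>, hs)"
  shows "hs = []" "goals_proved \<tau> gs (tms s) \<longleftrightarrow> (\<exists>\<delta>. \<forall>i < l. \<tau> i = subst \<delta> (\<alpha> i))"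
proof -
  have "fst ` set hs = {}" using assms by (auto simp: sld_invariant_def frontier_def)
  then show "hs = []" by simp
  then show "goals_proved \<tau> gs (tms s) \<longleftrightarrow> (\<exists>\<delta>. \<forall>i < l. \<tau> i = subst \<delta> (\<alpha> i))"
    using assms by (auto simp: sld_invariant_def open_proved_def)
qed

end

text \<open>Typing of the trigger puts its clauses into \<open>P\<close>, which bounds their
  variables. A solution is \<theta> itself, being its own instance under the identity.\<close>

lemma refutation_tile_solvable_forest:
  assumes lp: "logic_program arF arP P"
    and rt: "refutation_tile arF arP P (goal_conf l gs) s (subst_obs n \<theta>) m n"
  shows "solvable_forest gs s l"
proof
  note ty = refutation_tile_typed[OF lp rt]
  fix x c ws A
  assume x: "subtree_at (tms s) x = Some (Op (OClause c) ws)" and A: "A \<in> set (head c # body c)"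
  have "\<exists>\<tau>. has_sort (obs_sig arF P) (src s) u \<tau>" if "u \<in> set (tms s)" for u
    using ty(2) that by (auto simp: is_arr_def in_set_conv_nth)
  from subtree_at_has_sort[OF x this]
  obtain \<tau> where "has_sort (obs_sig arF P) (src s) (Op (OClause c) ws) \<tau>" by blast
  then have "c \<in> P" by (cases rule: has_sort.cases) (auto split: if_splits)
  then have "wf_atom arF arP (nvars c) A"
    using lp A by (auto simp: logic_program_def wf_clause_def)
  then show "atom_vars A \<subseteq> {..<nvars c}"
    by (auto simp: wf_atom_def atom_vars_def dest!: has_sort_vars)
next
  fix A assume A: "Some A \<in> set gs"
  show "atom_vars A \<subseteq> {..<l}"
    using goal_conf_vars[OF refutation_tile_typed(1)[OF lp rt] A] by (auto simp: atom_vars_def)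
next
  have "goals_proved (\<lambda>i. \<theta> ! i) gs (tms s)"
    unfolding refutation_tile_answers[OF lp rt] by (intro exI[of _ Var]) simp
  then show "\<exists>\<tau>. goals_proved \<tau> gs (tms s)" by blast
qed

theorem theorem4p10:
  fixes arF :: "'f \<Rightarrow> nat" and arP :: "'p \<Rightarrow> nat"
    and P :: "('f, 'p) clause set"
    and gs :: "('f, 'p) atom option list" and s :: "('f, 'p) oop arr"
    and \<theta> :: "'f tm list" and l m n :: nat
    and R :: "(node \<times> node) set" and xs :: "node list"
  assumes "logic_program arF arP P"
    and "refutation_tile arF arP P (goal_conf l gs) s (subst_obs n \<theta>) m n"
    and "linear_order_on (forest_nodes s) R" and "forest_order s \<subseteq> R"
    and "distinct xs" and "set xs = forest_nodes s" and "sorted_wrt (\<lambda>x y. (x, y) \<in> R) xs"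
  shows "(\<exists>V \<alpha>. sld_run (node_clause s) xs (sld_init l gs) (V, \<alpha>, [])) \<and>
    (\<forall>V \<alpha> hs. sld_run (node_clause s) xs (sld_init l gs) (V, \<alpha>, hs) \<longrightarrow>
       hs = [] \<and> same_answer l \<theta> \<alpha>)"
proof -
  interpret solvable_forest gs s l
    using refutation_tile_solvable_forest[OF assms(1,2)] .
  have final: "sld_invariant (forest_nodes s) S"
    if "sld_run (node_clause s) xs (sld_init l gs) S" for S
    using sld_run_invariant[OF that sld_invariant_init] assms(6) by simp
  \<comment> \<open>Were a node listed before its parent, \<open>R\<close> would relate the two in
    both directions, against antisymmetry; so the list meets the ordering assumption of
    \<open>sld_run_exists\<close>.\<close>
  have "length x = 1 \<or> butlast x \<in> {} \<union> set ys" if xs: "xs = ys @ x # zs" for ys x zs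
  proof (rule disjCI)
    assume "butlast x \<notin> {} \<union> set ys"
    show "length x = 1"
    proof (rule ccontr)
      assume "length x \<noteq> 1"
      moreover have x: "x \<in> forest_nodes s" using assms(6) xs by auto
      ultimately have parent: "butlast x \<in> forest_nodes s" by (rule_tac butlast_forest_nodes)
      have "butlast x \<noteq> x" using forest_nodes_nonempty[OF x]
        by (metis append_butlast_last_id append_self_conv not_Cons_self2)
      have "(butlast x, x) \<in> R"
        using assms(4) x parent by (auto simp: forest_order_def prefix_order.order_refl prefixeq_butlast)
      moreover have "butlast x \<in> set zs"
        using parent assms(6) xs \<open>butlast x \<noteq> x\<close> \<open>butlast x \<notin> {} \<union> set ys\<close> by auto
      then have "(x, butlast x) \<in> R"
        using assms(7) xs by (auto simp: sorted_wrt_append)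
      ultimately show False
        using assms(3) \<open>butlast x \<noteq> x\<close>
        by (auto simp: linear_order_on_def partial_order_on_def antisym_def)
    qed
  qed
  then obtain S where S: "sld_run (node_clause s) xs (sld_init l gs) S"
    using sld_run_exists[OF sld_invariant_init assms(5)] assms(6) by auto
  have "hs = [] \<and> same_answer l \<theta> \<alpha>"
    if run: "sld_run (node_clause s) xs (sld_init l gs) (V, \<alpha>, hs)" for V \<alpha> hs
  proof
    show "hs = []" using sld_invariant_complete(1)[OF final[OF run]] .
    \<comment> \<open>The instances of \<alpha> and those of \<theta> are both the solutions of the
      goal along the forest. Taking \<tau> to be \<alpha> and then \<theta> makes each an instance
      of the other.\<close>
    have iff: "(\<exists>\<delta>. \<forall>i < l. \<tau> i = subst \<delta> (\<alpha> i)) \<longleftrightarrow> (\<exists>\<delta>. \<forall>i < l. \<tau> i = subst \<delta> (\<theta> ! i))" for \<tau>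
      using sld_invariant_complete(2)[OF final[OF run]] refutation_tile_answers[OF assms(1,2)]
      by blast
    have "\<exists>\<delta>. \<forall>i < l. \<alpha> i = subst \<delta> (\<alpha> i)" by (intro exI[of _ Var]) simp
    then obtain \<epsilon> where \<epsilon>: "\<forall>i < l. \<alpha> i = subst \<epsilon> (\<theta> ! i)" using iff by blast
    have "\<exists>\<delta>. \<forall>i < l. \<theta> ! i = subst \<delta> (\<theta> ! i)" by (intro exI[of _ Var]) simp
    then obtain \<delta> where \<delta>: "\<forall>i < l. \<theta> ! i = subst \<delta> (\<alpha> i)" using iff[of "(!) \<theta>"] by blast
    show "same_answer l \<theta> \<alpha>"
      using \<delta> \<epsilon> refutation_tile_typed(4)[OF assms(1,2)]
      by (intro same_answer_if_mutual_instances[of \<theta> l \<delta> \<alpha> \<epsilon>]) auto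
  qed
  then show ?thesis using S by (cases S) blast
qed

end
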